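(* Let $C_{\mathsf{MSE}}>0$. There exist constants $c>0$ and $N_0\in\mathbb{N}$, depending only on $C_{\mathsf{MSE}}$, such that the following holds. For all integers $d\ge 1$ and $n\ge N_0$, every measurable $f\colon(\mathbb{R}^d)^n\to\mathbb{R}^d$ that is $(C_{\mathsf{MSE}},\frac{d}{n})$-uniformly MSE-accurate for the Gaussian class $\{\mathcal N(\mu,\mathbb I_d)\}_{\mu\in\mathbb R^d}$, and every $\eta\in(0,1)$ with $\lfloor \eta n\rfloor\ge 1$, we have \[\sup_{\mu\in\mathbb R^d}\mathsf{ES}_{\eta,2}(f;\mu)\ \ge\ c\left(\eta+\sqrt{\frac{\eta d}{n}}\right).\]
   Context: For datasets $x,x'\in(\mathbb R^d)^n$, the Hamming distance is $d_H(x,x')=\#\{i\in[n]: x_i\neq x_i'\}$. For a function $f\colon(\mathbb R^d)^n\to\mathbb R^d$ and $\eta\in(0,1)$, the pointwise empirical sensitivity is $S^f_\eta(X)=\sup_{X'\colon d_H(X,X')\le\lfloor\eta n\rfloor}\|f(X)-f(X')\|_2$. For $q\in\{1,2\}$, the distributional empirical sensitivity is $\mathsf{ES}_{\eta,q}(f;\mu)=\big(\mathbb E_{X\sim\mathcal N(\mu,\mathbb I_d)^{\otimes n}}[S^f_\eta(X)^q]\big)^{1/q}$. An estimator $f$ is $(C_{\mathsf{MSE}},\frac dn)$-uniformly MSE-accurate if $\sup_{\mu\in\mathbb R^d}\mathbb E_{X\sim\mathcal N(\mu,\mathbb I_d)^{\otimes n}}\|f(X)-\mu\|_2^2\le C_{\mathsf{MSE}}\frac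 dn$. *)

theory Defs
  imports "HOL-Probability.Probability"
begin

text \<open>Vectors in R^d are represented as functions nat => real (only coordinates j < d matter);
  a dataset in (R^d)^n is a function nat => (nat => real), an element of the product space
  below (extensional, i.e. coordinates outside the index ranges are undefined).\<close>

definition data_space :: "nat \<Rightarrow> nat \<Rightarrow> (nat \<Rightarrow> nat \<Rightarrow> real) set" where
  "data_space d n = (\<Pi>\<^sub>E i\<in>{..<n}. \<Pi>\<^sub>E j\<in>{..<d}. (UNIV :: real set))"

definition dist_d :: "nat \<Rightarrow> (nat \<Rightarrow> real) \<Rightarrow> (nat \<Rightarrow> real) \<Rightarrow> real" where
  "dist_d d x y = sqrt (\<Sum>j<d. (x j - y j)\<^sup>2)"

definition data_borel :: "nat \<Rightarrow> nat \<Rightarrow> (nat \<Rightarrow> nat \<Rightarrow> real) measure" where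
  "data_borel d n = (\<Pi>\<^sub>M i\<in>{..<n}. \<Pi>\<^sub>M j\<in>{..<d}. (lborel :: real measure))"

definition gauss :: "nat \<Rightarrow> (nat \<Rightarrow> real) \<Rightarrow> (nat \<Rightarrow> real) measure" where
  "gauss d \<mu> = (\<Pi>\<^sub>M j\<in>{..<d}. density lborel (normal_density (\<mu> j) 1))"

definition sample :: "nat \<Rightarrow> nat \<Rightarrow> (nat \<Rightarrow> real) \<Rightarrow> (nat \<Rightarrow> nat \<Rightarrow> real) measure" where
  "sample d n \<mu> = (\<Pi>\<^sub>M i\<in>{..<n}. gauss d \<mu>)"

definition hamming :: "nat \<Rightarrow> (nat \<Rightarrow> nat \<Rightarrow> real) \<Rightarrow> (nat \<Rightarrow> nat \<Rightarrow> real) \<Rightarrow> nat" where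
  "hamming n X X' = card {i \<in> {..<n}. X i \<noteq> X' i}"

definition emp_sens :: "nat \<Rightarrow> nat \<Rightarrow> ((nat \<Rightarrow> nat \<Rightarrow> real) \<Rightarrow> (nat \<Rightarrow> real)) \<Rightarrow> real
    \<Rightarrow> (nat \<Rightarrow> nat \<Rightarrow> real) \<Rightarrow> ennreal" where
  "emp_sens d n f \<eta> X =
     (SUP X' \<in> {X' \<in> data_space d n. hamming n X X' \<le> nat \<lfloor>\<eta> * real n\<rfloor>}.
        ennreal (dist_d d (f X) (f X')))"

definition ennsqrt :: "ennreal \<Rightarrow> ennreal" where
  "ennsqrt x = (if x = \<infinity> then \<infinity> else ennreal (sqrt (enn2real x)))"

definition ES2 :: "nat \<Rightarrow> nat \<Rightarrow> ((nat \<Rightarrow> nat \<Rightarrow> real) \<Rightarrow> (nat \<Rightarrow> real)) \<Rightarrow> real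
    \<Rightarrow> (nat \<Rightarrow> real) \<Rightarrow> ennreal" where
  "ES2 d n f \<eta> \<mu> = ennsqrt (\<integral>\<^sup>+ X. (emp_sens d n f \<eta> X)\<^sup>2 \<partial>sample d n \<mu>)"

definition unif_MSE_accurate :: "real \<Rightarrow> nat \<Rightarrow> nat \<Rightarrow> ((nat \<Rightarrow> nat \<Rightarrow> real) \<Rightarrow> (nat \<Rightarrow> real)) \<Rightarrow> bool" where
  "unif_MSE_accurate C d n f \<longleftrightarrow>
     (\<forall>\<mu>::nat \<Rightarrow> real. (\<integral>\<^sup>+ X. ennreal ((dist_d d (f X) \<mu>)\<^sup>2) \<partial>sample d n \<mu>)
        \<le> ennreal (C * real d / real n))"

definition estimator_measurable :: "nat \<Rightarrow> nat \<Rightarrow> ((nat \<Rightarrow> nat \<Rightarrow> real) \<Rightarrow> (nat \<Rightarrow> real)) \<Rightarrow> bool" where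
  "estimator_measurable d n f \<longleftrightarrow> (\<forall>j<d. (\<lambda>X. f X j) \<in> borel_measurable (data_borel d n))"

end

theory Submission
  imports Defs
begin

text \<open>Let \<open>k = \<lfloor>\<eta> n\<rfloor>\<close> and let \<open>\<sigma>\<close> bound the sensitivity \<open>ES2\<close> at every mean. The target is
  \<open>\<sigma> \<ge> c max(k / n, sqrt(k d) / n)\<close>. Since the estimator has bounded bias, telescoping its mean over a long
  grid shows that at some \<open>\<mu>\<close> its mean moves like \<open>\<mu>\<close> itself under a small shift.

  For \<open>d > k\<close>: at such a \<open>\<mu>\<close>, \<open>E \<langle>f(X), \<Sum>\<^sub>i (X\<^sub>i - \<mu>)\<rangle> \<ge> d / 2\<close>. Reflecting a block of \<open>k\<close> sample points about
  \<open>\<mu>\<close> preserves the law and flips the sign of the block score, so by Cauchy--Schwarz a block contributes at most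
  \<open>\<sigma> sqrt(k d) / 2\<close>, and there are about \<open>n / k\<close> blocks.

  For \<open>d \<le> k\<close>: couple the laws with means \<open>\<mu>\<close> and \<open>\<mu> + \<delta> e\<^sub>j\<close>, \<open>\<delta> = \<gamma> k / n\<close>, by the reflection coupling applied to
  each sample point. When at most \<open>k\<close> points are flipped, \<open>f\<close> moves by at most its sensitivity. The event of more
  than \<open>k\<close> flips has, given either sample, a conditional probability whose variance is tiny by Efron--Stein, so it is
  almost independent of \<open>f\<close>, and its contribution is controlled by the mean squared error alone.\<close>

section \<open>Product measures and reflections\<close>

text \<open>Transferred from \<open>Cauchy_Schwarz_nn_integral\<close> applied to absolute values;
  the pointwise bound by the sum of the squares supplies integrability of the product.\<close>

lemma Cauchy_Schwarz_integral:
  fixes f g :: "'a \<Rightarrow> real"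
  assumes [measurable]: "f \<in> borel_measurable M" "g \<in> borel_measurable M"
    and f2: "integrable M (\<lambda>x. (f x)\<^sup>2)" and g2: "integrable M (\<lambda>x. (g x)\<^sup>2)"
  shows "integrable M (\<lambda>x. f x * g x)"
    and "\<bar>\<integral>x. f x * g x \<partial>M\<bar> \<le> sqrt (\<integral>x. (f x)\<^sup>2 \<partial>M) * sqrt (\<integral>x. (g x)\<^sup>2 \<partial>M)"
proof -
  have "\<bar>f x * g x\<bar> \<le> (f x)\<^sup>2 + (g x)\<^sup>2" for x
  proof -
    have "0 \<le> (\<bar>f x\<bar> - \<bar>g x\<bar>)\<^sup>2" by simp
    hence "2 * (\<bar>f x\<bar> * \<bar>g x\<bar>) \<le> (f x)\<^sup>2 + (g x)\<^sup>2" by (simp add: power2_diff)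
    moreover have "0 \<le> \<bar>f x\<bar> * \<bar>g x\<bar>" by simp
    ultimately show ?thesis unfolding abs_mult by linarith
  qed
  thus int: "integrable M (\<lambda>x. f x * g x)"
    by (intro Bochner_Integration.integrable_bound[OF Bochner_Integration.integrable_add[OF f2 g2]]) auto
  have "(\<integral>\<^sup>+x. ennreal \<bar>f x\<bar> * ennreal \<bar>g x\<bar> \<partial>M)\<^sup>2
      \<le> (\<integral>\<^sup>+x. (ennreal \<bar>f x\<bar>)\<^sup>2 \<partial>M) * (\<integral>\<^sup>+x. (ennreal \<bar>g x\<bar>)\<^sup>2 \<partial>M)"
    by (intro Cauchy_Schwarz_nn_integral) auto
  also have "(\<integral>\<^sup>+x. (ennreal \<bar>f x\<bar>)\<^sup>2 \<partial>M) = ennreal (\<integral>x. (f x)\<^sup>2 \<partial>M)"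
    using f2 by (simp add: ennreal_power nn_integral_eq_integral)
  also have "(\<integral>\<^sup>+x. (ennreal \<bar>g x\<bar>)\<^sup>2 \<partial>M) = ennreal (\<integral>x. (g x)\<^sup>2 \<partial>M)"
    using g2 by (simp add: ennreal_power nn_integral_eq_integral)
  also have "(\<integral>\<^sup>+x. ennreal \<bar>f x\<bar> * ennreal \<bar>g x\<bar> \<partial>M) = ennreal (\<integral>x. \<bar>f x * g x\<bar> \<partial>M)"
    using integrable_abs[OF int]
    by (subst nn_integral_eq_integral[symmetric]) (auto simp: abs_mult ennreal_mult)
  finally have "(\<integral>x. \<bar>f x * g x\<bar> \<partial>M)\<^sup>2 \<le> (\<integral>x. (f x)\<^sup>2 \<partial>M) * (\<integral>x. (g x)\<^sup>2 \<partial>M)"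
    by (simp add: ennreal_power ennreal_mult[symmetric])
  hence "\<integral>x. \<bar>f x * g x\<bar> \<partial>M \<le> sqrt ((\<integral>x. (f x)\<^sup>2 \<partial>M) * (\<integral>x. (g x)\<^sup>2 \<partial>M))"
    by (rule real_le_rsqrt)
  hence "\<bar>\<integral>x. f x * g x \<partial>M\<bar> \<le> sqrt ((\<integral>x. (f x)\<^sup>2 \<partial>M) * (\<integral>x. (g x)\<^sup>2 \<partial>M))"
    by (rule order_trans[OF integral_abs_bound])
  thus "\<bar>\<integral>x. f x * g x \<partial>M\<bar> \<le> sqrt (\<integral>x. (f x)\<^sup>2 \<partial>M) * sqrt (\<integral>x. (g x)\<^sup>2 \<partial>M)"
    by (simp only: real_sqrt_mult)
qed

text \<open>Both measures agree on boxes: the indicator of a box is a product over the coordinates,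
  and Tonelli turns the integral of a product into a product of integrals.\<close>

lemma PiM_density:
  assumes "product_sigma_finite M" "product_sigma_finite (\<lambda>i. density (M i) (g i))"
    and I: "finite I" and g[measurable]: "\<And>i. g i \<in> borel_measurable (M i)"
  shows "PiM I (\<lambda>i. density (M i) (g i)) = density (PiM I M) (\<lambda>x. \<Prod>i\<in>I. g i (x i))"
proof (rule sym, rule product_sigma_finite.PiM_eqI[OF assms(2) I])
  interpret product_sigma_finite M by fact
  have sets_eq: "sets (PiM I (\<lambda>i. density (M i) (g i))) = sets (PiM I M)"
    by (intro sets_PiM_cong) auto
  show "sets (density (PiM I M) (\<lambda>x. \<Prod>i\<in>I. g i (x i))) = sets (PiM I (\<lambda>i. density (M i) (g i)))"
    by (simp add: sets_eq)
  fix A assume A: "\<And>i. i \<in> I \<Longrightarrow> A i \<in> sets (density (M i) (g i))"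
  hence A'[measurable]: "\<And>i. i \<in> I \<Longrightarrow> A i \<in> sets (M i)" by simp
  have "emeasure (density (PiM I M) (\<lambda>x. \<Prod>i\<in>I. g i (x i))) (Pi\<^sub>E I A)
    = (\<integral>\<^sup>+x. (\<Prod>i\<in>I. g i (x i)) * indicator (Pi\<^sub>E I A) x \<partial>PiM I M)"
    using I A' by (intro emeasure_density) (auto intro!: sets_PiM_I_finite borel_measurable_prod_ennreal)
  also have "\<dots> = (\<integral>\<^sup>+x. (\<Prod>i\<in>I. g i (x i) * indicator (A i) (x i)) \<partial>PiM I M)"
  proof (rule nn_integral_cong)
    fix x assume x: "x \<in> space (PiM I M)"
    have "indicator (Pi\<^sub>E I A) x = (\<Prod>i\<in>I. indicator (A i) (x i) :: ennreal)"
      using x I by (auto simp: indicator_def space_PiM PiE_iff prod.neutral split: if_splits intro!: prod_zero[symmetric])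
    thus "(\<Prod>i\<in>I. g i (x i)) * indicator (Pi\<^sub>E I A) x = (\<Prod>i\<in>I. g i (x i) * indicator (A i) (x i))"
      by (simp add: prod.distrib)
  qed
  also have "\<dots> = (\<Prod>i\<in>I. \<integral>\<^sup>+x. g i x * indicator (A i) x \<partial>M i)"
    using I by (intro product_nn_integral_prod) auto
  also have "\<dots> = (\<Prod>i\<in>I. emeasure (density (M i) (g i)) (A i))"
    by (intro prod.cong refl emeasure_density[symmetric]) auto
  finally show "emeasure (density (PiM I M) (\<lambda>x. \<Prod>i\<in>I. g i (x i))) (Pi\<^sub>E I A)
    = (\<Prod>i\<in>I. emeasure (density (M i) (g i)) (A i))" .
qed

text \<open>The preimage of a box under a coordinatewise map is again a box, and boxes determine the
  product measure.\<close>

lemma distr_PiM_componentwise: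
  assumes M: "product_sigma_finite M" and I: "finite I"
    and f[measurable]: "\<And>i. f i \<in> measurable (M i) (M i)"
    and eq: "\<And>i. distr (M i) (M i) (f i) = M i"
  shows "distr (PiM I M) (PiM I M) (\<lambda>x. \<lambda>i\<in>I. f i (x i)) = PiM I M"
proof (rule product_sigma_finite.PiM_eqI[OF M I])
  interpret product_sigma_finite M by fact
  fix A assume A[measurable]: "\<And>i. i \<in> I \<Longrightarrow> A i \<in> sets (M i)"
  have [measurable]: "(\<lambda>x. \<lambda>i\<in>I. f i (x i)) \<in> measurable (PiM I M) (PiM I M)"
    by measurable
  have "emeasure (distr (PiM I M) (PiM I M) (\<lambda>x. \<lambda>i\<in>I. f i (x i))) (Pi\<^sub>E I A)
     = emeasure (PiM I M) ((\<lambda>x. \<lambda>i\<in>I. f i (x i)) -` Pi\<^sub>E I A \<inter> space (PiM I M))"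
    using I A by (intro emeasure_distr) (auto intro!: sets_PiM_I_finite)
  also have "(\<lambda>x. \<lambda>i\<in>I. f i (x i)) -` Pi\<^sub>E I A \<inter> space (PiM I M)
      = Pi\<^sub>E I (\<lambda>i. f i -` A i \<inter> space (M i))"
    by (auto simp: space_PiM PiE_iff)
  also have "emeasure (PiM I M) \<dots> = (\<Prod>i\<in>I. emeasure (M i) (f i -` A i \<inter> space (M i)))"
    using I by (intro emeasure_PiM) auto
  also have "\<dots> = (\<Prod>i\<in>I. emeasure (distr (M i) (M i) (f i)) (A i))"
    by (intro prod.cong refl emeasure_distr[symmetric]) auto
  also have "\<dots> = (\<Prod>i\<in>I. emeasure (M i) (A i))"
    by (simp add: eq)
  finally show "emeasure (distr (PiM I M) (PiM I M) (\<lambda>x. \<lambda>i\<in>I. f i (x i))) (Pi\<^sub>E I A)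
     = (\<Prod>i\<in>I. emeasure (M i) (A i))" .
qed simp

section \<open>Gaussian samples and their Lebesgue densities\<close>

lemma product_sigma_finite_lborel: "product_sigma_finite (\<lambda>_. lborel :: real measure)"
  by unfold_locales

lemma product_sigma_finite_PiM_lborel:
  "product_sigma_finite (\<lambda>_. \<Pi>\<^sub>M j\<in>{..<d::nat}. (lborel :: real measure))"
  by (intro product_sigma_finite.intro product_sigma_finite.sigma_finite product_sigma_finite_lborel) simp

lemma prob_space_gauss: "prob_space (gauss d \<mu>)"
  unfolding gauss_def by (intro prob_space_PiM prob_space_normal_density) simp

lemma prob_space_sample: "prob_space (sample d n \<mu>)"
  unfolding sample_def by (intro prob_space_PiM prob_space_gauss)

lemma sets_gauss[measurable_cong]: "sets (gauss d \<mu>) = sets (\<Pi>\<^sub>M j\<in>{..<d}. (lborel :: real measure))"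
  unfolding gauss_def by (intro sets_PiM_cong) auto

lemma sets_sample[measurable_cong]: "sets (sample d n \<mu>) = sets (data_borel d n)"
  unfolding sample_def data_borel_def by (intro sets_PiM_cong sets_gauss) auto

lemma space_data_borel: "space (data_borel d n) = data_space d n"
  unfolding data_borel_def data_space_def by (simp add: space_PiM)

lemma space_sample: "space (sample d n \<mu>) = data_space d n"
  using sets_eq_imp_space_eq[OF sets_sample] space_data_borel by simp

lemma measurable_entry[measurable]:
  "i < n \<Longrightarrow> j < d \<Longrightarrow> (\<lambda>X. X i j) \<in> borel_measurable (data_borel d n)"
proof -
  assume "i < n" "j < d"
  hence "(\<lambda>X. X i) \<in> measurable (data_borel d n) (\<Pi>\<^sub>M j\<in>{..<d}. lborel)"
    and [measurable]: "(\<lambda>x. x j) \<in> measurable (\<Pi>\<^sub>M j\<in>{..<d}. lborel) (borel :: real measure)"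
    unfolding data_borel_def by (auto intro!: measurable_component_singleton)
  hence [measurable]: "(\<lambda>X. X i) \<in> measurable (data_borel d n) (\<Pi>\<^sub>M j\<in>{..<d}. lborel)" by simp
  show ?thesis by measurable
qed

text \<open>The joint Lebesgue density of \<open>sample d n \<mu>\<close>. It turns shifts of the
  mean and reflections of the data into pointwise identities.\<close>

definition dens :: "nat \<Rightarrow> nat \<Rightarrow> (nat \<Rightarrow> real) \<Rightarrow> (nat \<Rightarrow> nat \<Rightarrow> real) \<Rightarrow> real" where
  "dens d n \<mu> X = (\<Prod>i<n. \<Prod>j<d. normal_density (\<mu> j) 1 (X i j))"

lemma dens_pos: "dens d n \<mu> X > 0"
  unfolding dens_def by (auto intro!: prod_pos simp: normal_density_pos)

lemma measurable_dens[measurable]: "dens d n \<mu> \<in> borel_measurable (data_borel d n)"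
proof -
  have "(\<lambda>X. normal_density (\<mu> j) 1 (X i j)) \<in> borel_measurable (data_borel d n)" if "i < n" "j < d" for i j
    using that by measurable
  hence "(\<lambda>X. \<Prod>i<n. \<Prod>j<d. normal_density (\<mu> j) 1 (X i j)) \<in> borel_measurable (data_borel d n)"
    by (intro borel_measurable_prod) simp
  thus ?thesis by (simp add: dens_def[abs_def])
qed

lemma gauss_eq_density:
  "gauss d \<mu> = density (\<Pi>\<^sub>M j\<in>{..<d}. (lborel::real measure)) (\<lambda>x. \<Prod>j<d. ennreal (normal_density (\<mu> j) 1 (x j)))"
  unfolding gauss_def
proof (rule PiM_density[OF product_sigma_finite_lborel])
  interpret prob_space "density lborel (\<lambda>x. ennreal (normal_density (\<mu> i) 1 x))" for i
    by (rule prob_space_normal_density) simp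
  show "product_sigma_finite (\<lambda>i. density lborel (\<lambda>x. ennreal (normal_density (\<mu> i) 1 x)))"
    by unfold_locales
qed auto

lemma sample_eq_density: "sample d n \<mu> = density (data_borel d n) (\<lambda>X. ennreal (dens d n \<mu> X))"
proof -
  let ?g = "\<lambda>x. \<Prod>j<d. ennreal (normal_density (\<mu> j) 1 (x j))"
  let ?L = "\<Pi>\<^sub>M j\<in>{..<d}. (lborel::real measure)"
  have m[measurable]: "?g \<in> borel_measurable ?L"
    by (intro borel_measurable_prod_ennreal measurable_compose[OF measurable_component_singleton]) auto
  interpret prob_space "gauss d \<mu>" by (rule prob_space_gauss)
  have "product_sigma_finite (\<lambda>i::nat. gauss d \<mu>)" by unfold_locales
  hence "PiM {..<n} (\<lambda>i. density ?L ?g) = density (PiM {..<n} (\<lambda>_. ?L)) (\<lambda>X. \<Prod>i<n. ?g (X i))"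
    by (intro PiM_density product_sigma_finite_PiM_lborel) (auto simp: gauss_eq_density[symmetric])
  thus ?thesis
    by (simp add: sample_def gauss_eq_density data_borel_def dens_def prod_ennreal prod_nonneg)
qed

lemma measurable_sample_iff: "measurable (sample d n \<mu>) N = measurable (data_borel d n) N"
  by (rule measurable_cong_sets) (auto simp: sets_sample)

lemma integral_sample:
  fixes h :: "_ \<Rightarrow> real"
  assumes [measurable]: "h \<in> borel_measurable (data_borel d n)"
  shows "integral\<^sup>L (sample d n \<mu>) h = (\<integral>X. dens d n \<mu> X * h X \<partial>data_borel d n)"
    and "integrable (sample d n \<mu>) h = integrable (data_borel d n) (\<lambda>X. dens d n \<mu> X * h X)"
  unfolding sample_eq_density
  by (subst integral_density integrable_density; auto intro: less_imp_le dens_pos)+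

text \<open>The set \<open>T\<close> consists of single entries, so one definition serves whole rows
  (\<open>K \<times> {..<d}\<close>) and one coordinate of some rows
  (\<open>T \<times> {j}\<close>). The restrictions make every value extensional, as
  \<open>data_space\<close> demands.\<close>

definition reflect :: "nat \<Rightarrow> nat \<Rightarrow> (nat \<times> nat) set \<Rightarrow> (nat \<Rightarrow> real) \<Rightarrow> (nat \<Rightarrow> nat \<Rightarrow> real) \<Rightarrow> nat \<Rightarrow> nat \<Rightarrow> real" where
  "reflect d n T c X = (\<lambda>i\<in>{..<n}. \<lambda>j\<in>{..<d}. if (i, j) \<in> T then 2 * c j - X i j else X i j)"

lemma lborel_distr_reflect: "distr lborel lborel (\<lambda>x. a - x) = (lborel :: real measure)"
proof -
  have "(lborel :: real measure) = density (distr lborel borel (\<lambda>x. a + (-1) * x)) (\<lambda>_. ennreal \<bar>-1\<bar>)"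
    using lborel_real_affine[of "-1" a] by simp
  also have "\<dots> = distr lborel borel (\<lambda>x. a - x)" by (simp add: density_1)
  also have "\<dots> = distr lborel lborel (\<lambda>x. a - x)" by (rule distr_cong) auto
  finally show ?thesis by simp
qed

lemma measurable_reflect[measurable]:
  "reflect d n T c \<in> measurable (data_borel d n) (data_borel d n)"
  and distr_reflect: "distr (data_borel d n) (data_borel d n) (reflect d n T c) = data_borel d n"
proof -
  let ?r = "\<lambda>i j x. if (i, j) \<in> T then 2 * c j - x else (x::real)"
  let ?L = "\<Pi>\<^sub>M j\<in>{..<d}. (lborel::real measure)"
  let ?f = "\<lambda>i x. \<lambda>j\<in>{..<d}. ?r i j (x j)"
  have f: "?f i \<in> measurable ?L ?L" for i
    by (intro measurable_restrict) measurable
  have "distr lborel lborel (?r i j) = lborel" for i j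
    by (cases "(i, j) \<in> T") (simp_all add: lborel_distr_reflect distr_id2)
  hence d: "distr ?L ?L (?f i) = ?L" for i
    by (intro distr_PiM_componentwise product_sigma_finite_lborel) simp_all
  have eq: "reflect d n T c = (\<lambda>X. \<lambda>i\<in>{..<n}. ?f i (X i))"
    by (simp add: reflect_def fun_eq_iff)
  show "reflect d n T c \<in> measurable (data_borel d n) (data_borel d n)"
    unfolding eq data_borel_def
    by (intro measurable_restrict measurable_compose[OF _ f] measurable_component_singleton)
  show "distr (data_borel d n) (data_borel d n) (reflect d n T c) = data_borel d n"
    unfolding eq data_borel_def
    by (intro distr_PiM_componentwise product_sigma_finite_PiM_lborel f d) simp
qed

lemma reflect_in_data_space: "reflect d n T c X \<in> data_space d n"
  by (auto simp: reflect_def data_space_def)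

lemma reflect_apply: "i < n \<Longrightarrow> j < d \<Longrightarrow>
    reflect d n T c X i j = (if (i, j) \<in> T then 2 * c j - X i j else X i j)"
  by (simp add: reflect_def)

text \<open>Change of variables: Lebesgue measure is invariant under \<open>reflect\<close>, so only
  the densities have to be matched. The weights \<open>w\<close> and \<open>w'\<close> absorb either
  a change of sign (block score) or the flip probabilities of a coupling.\<close>

lemma integral_reflect:
  fixes h w w' :: "_ \<Rightarrow> real"
  assumes [measurable]: "h \<in> borel_measurable (data_borel d n)" "w \<in> borel_measurable (data_borel d n)"
      "w' \<in> borel_measurable (data_borel d n)"
    and eq: "\<And>X. dens d n \<nu> (reflect d n T c X) * w (reflect d n T c X) = dens d n \<mu> X * w' X"
  shows "(\<integral>X. h X * w X \<partial>sample d n \<nu>) = (\<integral>X. h (reflect d n T c X) * w' X \<partial>sample d n \<mu>)"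
    and "integrable (sample d n \<nu>) (\<lambda>X. h X * w X) =
         integrable (sample d n \<mu>) (\<lambda>X. h (reflect d n T c X) * w' X)"
proof -
  let ?D = "data_borel d n" and ?R = "reflect d n T c"
  have e: "dens d n \<nu> (?R X) * (h (?R X) * w (?R X)) = dens d n \<mu> X * (h (?R X) * w' X)" for X
    using eq[of X] by (simp add: algebra_simps)
  have "(\<integral>X. h X * w X \<partial>sample d n \<nu>) = (\<integral>X. dens d n \<nu> X * (h X * w X) \<partial>distr ?D ?D ?R)"
    by (simp add: integral_sample distr_reflect)
  also have "\<dots> = (\<integral>X. dens d n \<nu> (?R X) * (h (?R X) * w (?R X)) \<partial>?D)"
    by (intro integral_distr) auto
  finally show "(\<integral>X. h X * w X \<partial>sample d n \<nu>) = (\<integral>X. h (?R X) * w' X \<partial>sample d n \<mu>)"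
    by (simp add: e integral_sample)
  have "integrable (sample d n \<nu>) (\<lambda>X. h X * w X) = integrable (distr ?D ?D ?R) (\<lambda>X. dens d n \<nu> X * (h X * w X))"
    by (simp add: integral_sample distr_reflect)
  also have "\<dots> = integrable ?D (\<lambda>X. dens d n \<nu> (?R X) * (h (?R X) * w (?R X)))"
    by (intro integrable_distr_eq) auto
  finally show "integrable (sample d n \<nu>) (\<lambda>X. h X * w X) = integrable (sample d n \<mu>) (\<lambda>X. h (?R X) * w' X)"
    by (simp add: e integral_sample)
qed

section \<open>Variance of Bernoulli mixtures\<close>

text \<open>Probability that exactly the trials in \<open>T\<close> succeed, for independent trials
  with success probabilities \<open>q i\<close>; \<open>bern_mean\<close> is the resulting
  expectation of \<open>F\<close> of the number of successes.\<close>

definition bern :: "nat \<Rightarrow> (nat \<Rightarrow> real) \<Rightarrow> nat set \<Rightarrow> real" where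
  "bern n q T = (\<Prod>i<n. if i \<in> T then q i else 1 - q i)"

definition bern_mean :: "nat \<Rightarrow> (nat \<Rightarrow> real) \<Rightarrow> (nat \<Rightarrow> real) \<Rightarrow> real" where
  "bern_mean n q F = (\<Sum>T\<in>Pow {..<n}. F (card T) * bern n q T)"

lemma bern_mean_0: "bern_mean 0 q F = F 0"
  by (simp add: bern_mean_def bern_def)

text \<open>Condition on the last trial: a subset of \<open>{..<Suc n}\<close> either omits
  \<open>n\<close> or arises from a subset of \<open>{..<n}\<close> by inserting it. This recursion
  drives the inductions below.\<close>

lemma bern_mean_Suc:
  "bern_mean (Suc n) q F = (1 - q n) * bern_mean n q F + q n * bern_mean n q (\<lambda>m. F (Suc m))"
proof -
  have disj: "Pow {..<n} \<inter> insert n ` Pow {..<n} = {}" by auto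
  have inj: "inj_on (insert n) (Pow {..<n})"
    by (rule inj_onI) (auto dest!: insert_ident[THEN iffD1, rotated 2])
  have "bern_mean (Suc n) q F = (\<Sum>T\<in>Pow {..<n} \<union> insert n ` Pow {..<n}. F (card T) * bern (Suc n) q T)"
    by (simp add: bern_mean_def lessThan_Suc Pow_insert)
  also have "\<dots> = (\<Sum>T\<in>Pow {..<n}. F (card T) * bern (Suc n) q T)
      + (\<Sum>T\<in>Pow {..<n}. F (card (insert n T)) * bern (Suc n) q (insert n T))"
    by (subst sum.union_disjoint[OF _ _ disj]) (simp_all add: sum.reindex[OF inj])
  also have "(\<Sum>T\<in>Pow {..<n}. F (card T) * bern (Suc n) q T) = (1 - q n) * bern_mean n q F"
    unfolding bern_mean_def sum_distrib_left
    by (intro sum.cong refl) (auto simp: bern_def)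
  also have "(\<Sum>T\<in>Pow {..<n}. F (card (insert n T)) * bern (Suc n) q (insert n T))
      = q n * bern_mean n q (\<lambda>m. F (Suc m))"
    unfolding bern_mean_def sum_distrib_left
  proof (intro sum.cong refl)
    fix T assume T: "T \<in> Pow {..<n}"
    hence "finite T" "n \<notin> T" by (auto intro: finite_subset)
    hence c: "card (insert n T) = Suc (card T)" by simp
    have "(\<Prod>i<n. if i = n \<or> i \<in> T then q i else 1 - q i) = (\<Prod>i<n. if i \<in> T then q i else 1 - q i)"
      by (intro prod.cong) auto
    thus "F (card (insert n T)) * bern (Suc n) q (insert n T) = q n * (F (Suc (card T)) * bern n q T)"
      unfolding c by (simp add: bern_def)
  qed
  finally show ?thesis .
qed

lemma bern_mean_cong: "(\<And>i. i < n \<Longrightarrow> q i = q' i) \<Longrightarrow> bern_mean n q F = bern_mean n q' F"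
  unfolding bern_mean_def bern_def by (intro sum.cong arg_cong2[where f="(*)"] prod.cong refl) auto

lemma bern_mean_const: "bern_mean n q (\<lambda>_. c) = c"
  by (induction n) (auto simp: bern_mean_0 bern_mean_Suc algebra_simps)

lemma bern_nonneg: "(\<And>i. i < n \<Longrightarrow> 0 \<le> q i \<and> q i \<le> 1) \<Longrightarrow> 0 \<le> bern n q T"
  unfolding bern_def by (intro prod_nonneg) auto

lemma bern_mean_mono:
  assumes "\<And>i. i < n \<Longrightarrow> 0 \<le> q i \<and> q i \<le> 1" "\<And>m. F m \<le> G m"
  shows "bern_mean n q F \<le> bern_mean n q G"
  unfolding bern_mean_def using assms by (intro sum_mono mult_right_mono bern_nonneg) auto

lemma bern_mean_nonneg:
  assumes "\<And>i. i < n \<Longrightarrow> 0 \<le> q i \<and> q i \<le> 1" "\<And>m. 0 \<le> F m"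
  shows "0 \<le> bern_mean n q F"
  unfolding bern_mean_def using assms by (intro sum_nonneg mult_nonneg_nonneg bern_nonneg) auto

lemma bern_mean_diff: "bern_mean n q (\<lambda>m. F m - G m) = bern_mean n q F - bern_mean n q G"
  by (simp add: bern_mean_def left_diff_distrib sum_subtractf)

lemma convex_combination_square:
  fixes a b p :: real
  assumes "0 \<le> p" "p \<le> 1"
  shows "((1 - p) * a + p * b)\<^sup>2 \<le> (1 - p) * a\<^sup>2 + p * b\<^sup>2"
proof -
  have "(1 - p) * a\<^sup>2 + p * b\<^sup>2 - ((1 - p) * a + p * b)\<^sup>2 = p * (1 - p) * (a - b)\<^sup>2"
    by (simp add: power2_eq_square algebra_simps)
  also have "\<dots> \<ge> 0" using assms by simp
  finally show ?thesis by simp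
qed

text \<open>Jensen's inequality for the square, by iterating the two-point case along the
  recursion.\<close>

lemma bern_mean_square_le:
  assumes "\<And>i. i < n \<Longrightarrow> 0 \<le> q i \<and> q i \<le> 1"
  shows "(bern_mean n q F)\<^sup>2 \<le> bern_mean n q (\<lambda>m. (F m)\<^sup>2)"
  using assms
proof (induction n arbitrary: F)
  case (Suc n)
  have q: "0 \<le> q n" "q n \<le> 1" using Suc.prems by auto
  have "(bern_mean (Suc n) q F)\<^sup>2 \<le> (1 - q n) * (bern_mean n q F)\<^sup>2 + q n * (bern_mean n q (\<lambda>m. F (Suc m)))\<^sup>2"
    unfolding bern_mean_Suc by (rule convex_combination_square[OF q])
  also have "\<dots> \<le> bern_mean (Suc n) q (\<lambda>m. (F m)\<^sup>2)"
    unfolding bern_mean_Suc using q Suc.prems by (intro add_mono mult_left_mono Suc.IH) auto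
  finally show ?case .
qed (simp add: bern_mean_0)

lemma bern_mean_id: "bern_mean n (\<lambda>_. p) real = n * p"
proof -
  \<comment> \<open>The additive constant is there because the recursion shifts the argument of
    \<open>F\<close> by one.\<close>
  have "bern_mean n (\<lambda>_. p) (\<lambda>m. real m + c) = n * p + c" for c
  proof (induction n arbitrary: c)
    case (Suc n)
    have e: "(\<lambda>m. real (Suc m) + c) = (\<lambda>m. real m + (c + 1))" by auto
    show ?case unfolding bern_mean_Suc Suc e by (simp add: algebra_simps)
  qed (simp add: bern_mean_0)
  from this[of 0] show ?thesis by simp
qed

text \<open>A binomial point probability is at most the Poisson weight without its exponential
  factor. The induction step amounts to \<open>x ^ k + k * p * x ^ (k - 1) \<le> (x + p) ^ k\<close>
  with \<open>x = n * p\<close>.\<close>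

lemma bern_mean_point_le:
  assumes p: "0 \<le> p" "p \<le> 1"
  shows "bern_mean n (\<lambda>_. p) (\<lambda>m. if m = k then 1 else 0) \<le> (n * p) ^ k / fact k"
proof (induction n arbitrary: k)
  case 0 show ?case by (simp add: bern_mean_0)
next
  case (Suc n)
  show ?case
  proof (cases k)
    case 0
    have "bern_mean (Suc n) (\<lambda>_. p) (\<lambda>m. if m = k then 1 else 0)
       \<le> bern_mean (Suc n) (\<lambda>_. p) (\<lambda>m. 1)" using p by (intro bern_mean_mono) auto
    thus ?thesis by (simp add: 0 bern_mean_const)
  next
    case (Suc k')
    let ?x = "real n * p"
    have z: "bern_mean n (\<lambda>_. p) (\<lambda>m. if Suc m = k then 1 else 0) \<le> ?x ^ k' / fact k'"
      using Suc.IH[of k'] by (simp add: Suc)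
    have "(1 - p) * bern_mean n (\<lambda>_. p) (\<lambda>m. if m = k then 1 else 0) \<le> 1 * (?x ^ k / fact k)"
      using p by (intro mult_mono Suc.IH bern_mean_nonneg) simp_all
    hence "bern_mean (Suc n) (\<lambda>_. p) (\<lambda>m. if m = k then 1 else 0)
      \<le> 1 * (?x ^ k / fact k) + p * (?x ^ k' / fact k')"
      unfolding bern_mean_Suc using mult_left_mono[OF z p(1)] by (rule add_mono)
    also have "\<dots> = (?x ^ k + real k * p * ?x ^ k') / fact k"
    proof -
      have "?x ^ k' / fact k' = real k * ?x ^ k' / fact k"
        unfolding Suc fact_Suc by (simp del: of_nat_Suc)
      thus ?thesis by (simp add: add_divide_distrib)
    qed
    also have "?x ^ k + real k * p * ?x ^ k' \<le> (?x + p) ^ k"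
    \<comment> \<open>Bernoulli's inequality is applied to \<open>p / y\<close> with
      \<open>y = n * p\<close>, so a vanishing \<open>n * p\<close> is treated apart.\<close>
    proof (cases "n = 0 \<or> p = 0")
      case True
      thus ?thesis using p by (cases k') (auto simp: Suc)
    next
      case False
      hence x: "?x > 0" using p by auto
      define y where "y = ?x"
      have y: "y > 0" using x by (simp add: y_def)
      have "1 + real k * (p / y) \<le> (1 + p / y) ^ k"
        by (rule Bernoulli_inequality) (use y p in \<open>simp add: order_trans[OF _ divide_nonneg_pos]\<close>)
      hence "y ^ k * (1 + real k * (p / y)) \<le> y ^ k * (1 + p / y) ^ k"
        using y by (intro mult_left_mono) auto
      also have "\<dots> = (y + p) ^ k"
        using y by (simp add: power_mult_distrib[symmetric] distrib_left)
      also have "y ^ k * (1 + real k * (p / y)) = y ^ k + real k * p * y ^ k'"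
        using y by (simp add: Suc distrib_left)
      finally have "y ^ k + real k * p * y ^ k' \<le> (y + p) ^ k" .
      thus ?thesis unfolding y_def .
    qed
    finally show ?thesis by (simp add: algebra_simps divide_right_mono)
  qed
qed

text \<open>Independence of the last point from the first \<open>n\<close>. By \<open>hc\<close> the
  function \<open>h\<close> sees only those coordinates, so the same \<open>h\<close> may be
  integrated over both product spaces.\<close>

lemma (in prob_space) PiM_integral_Suc:
  fixes g :: "'a \<Rightarrow> real" and h :: "(nat \<Rightarrow> 'a) \<Rightarrow> real"
  assumes g[measurable]: "g \<in> borel_measurable M" and gb: "\<And>x. \<bar>g x\<bar> \<le> G"
    and h[measurable]: "h \<in> borel_measurable (PiM {..<n} (\<lambda>_. M))" and hb: "\<And>x. \<bar>h x\<bar> \<le> H"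
    and hc: "\<And>x y. (\<And>i. i < n \<Longrightarrow> x i = y i) \<Longrightarrow> h x = h y"
  shows "(\<integral>X. g (X n) * h X \<partial>PiM {..<Suc n} (\<lambda>_. M))
    = (\<integral>x. g x \<partial>M) * (\<integral>X. h X \<partial>PiM {..<n} (\<lambda>_. M))"
proof -
  interpret PF: product_sigma_finite "\<lambda>_::nat. M" by unfold_locales
  interpret P: prob_space "PiM {..<Suc n} (\<lambda>_. M)" by (intro prob_space_PiM prob_space_axioms)
  have r: "h (restrict X {..<n}) = h X" for X by (rule hc) auto
  have "(\<lambda>X. h (restrict X {..<n})) \<in> borel_measurable (PiM {..<Suc n} (\<lambda>_. M))"
    by (intro measurable_compose[OF measurable_restrict_subset h]) auto
  hence h'[measurable]: "h \<in> borel_measurable (PiM {..<Suc n} (\<lambda>_. M))" by (simp add: r)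
  have b: "\<bar>g (X n) * h X\<bar> \<le> G * H" for X
    unfolding abs_mult using gb[of "X n"] hb[of X] by (intro mult_mono) auto
  have int: "integrable (PiM {..<Suc n} (\<lambda>_. M)) (\<lambda>X. g (X n) * h X)"
    using b by (intro P.integrable_const_bound[of _ "G * H"]) auto
  have "(\<integral>X. g (X n) * h X \<partial>PiM (insert n {..<n}) (\<lambda>_. M))
    = (\<integral>X. (\<integral>y. g ((X(n := y)) n) * h (X(n := y)) \<partial>M) \<partial>PiM {..<n} (\<lambda>_. M))"
    using int by (intro PF.product_integral_insert) (auto simp: lessThan_Suc)
  also have "\<dots> = (\<integral>X. (\<integral>y. g y * h X \<partial>M) \<partial>PiM {..<n} (\<lambda>_. M))"
  proof -
    have "h (X(n := y)) = h X" for X y by (rule hc) auto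
    thus ?thesis by simp
  qed
  also have "\<dots> = (\<integral>x. g x \<partial>M) * (\<integral>X. h X \<partial>PiM {..<n} (\<lambda>_. M))" by simp
  finally show ?thesis by (simp add: lessThan_Suc)
qed

text \<open>Two-stage experiment: draw i.i.d. points from \<open>M\<close>, then flip point
  \<open>i\<close> with probability \<open>p (X i)\<close>. Then \<open>B n F X\<close> is the
  conditional mean of \<open>F\<close> of the number of flips given the points, and
  \<open>mp\<close> the overall flip probability of one point.\<close>

locale bernoulli_mixture = prob_space M for M :: "'a measure" +
  fixes p :: "'a \<Rightarrow> real"
  assumes p_meas[measurable]: "p \<in> borel_measurable M" and p01: "0 \<le> p x" "p x \<le> 1"
begin

abbreviation "S n \<equiv> PiM {..<n::nat} (\<lambda>_. M)"
abbreviation "mp \<equiv> \<integral>x. p x \<partial>M"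
abbreviation "B n F X \<equiv> bern_mean n (\<lambda>i. p (X i)) F"

lemma mp01: "0 \<le> mp" "mp \<le> 1"
  using p01 by (auto intro!: integral_nonneg_AE integral_le_const integrable_const_bound[of _ 1])

lemma B_meas: "n \<le> m \<Longrightarrow> B n F \<in> borel_measurable (S m)"
proof (induction n arbitrary: F)
  case (Suc n)
  hence [measurable]: "B n F \<in> borel_measurable (S m)" "B n (\<lambda>i. F (Suc i)) \<in> borel_measurable (S m)" "n \<in> {..<m}" by auto
  show ?case unfolding bern_mean_Suc by measurable
qed (simp add: bern_mean_0)

lemmas B_meas' [measurable] = B_meas[OF order_refl] B_meas[of n "Suc n" for n, simplified]

lemma B_local: "(\<And>i. i < n \<Longrightarrow> x i = y i) \<Longrightarrow> B n F x = B n F y"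
  by (intro bern_mean_cong) auto

lemma B_bounded: "\<exists>c. \<forall>X. \<bar>B n F X\<bar> \<le> c"
proof (intro exI allI)
  fix X
  have "\<bar>B n F X\<bar> \<le> (\<Sum>T\<in>Pow {..<n}. \<bar>F (card T)\<bar> * 1)"
    unfolding bern_mean_def
  proof (intro order_trans[OF sum_abs] sum_mono)
    fix T
    have "bern n (\<lambda>i. p (X i)) T \<le> (\<Prod>i<n. 1)" unfolding bern_def
      using p01 by (intro prod_mono) auto
    moreover have "0 \<le> bern n (\<lambda>i. p (X i)) T" using p01 by (intro bern_nonneg) auto
    ultimately show "\<bar>F (card T) * bern n (\<lambda>i. p (X i)) T\<bar> \<le> \<bar>F (card T)\<bar> * 1"
      unfolding abs_mult by (intro mult_left_mono) auto
  qed
  thus "\<bar>B n F X\<bar> \<le> (\<Sum>T\<in>Pow {..<n}. \<bar>F (card T)\<bar> * 1)" .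
qed

lemma prob_S: "prob_space (S n)" by (intro prob_space_PiM prob_space_axioms)

text \<open>Averaging over the points makes the flips i.i.d. with success probability
  \<open>mp\<close>; the last point is split off by independence.\<close>

lemma B_integral: "(\<integral>X. B n F X \<partial>S n) = bern_mean n (\<lambda>_. mp) F"
proof (induction n arbitrary: F)
  case 0
  interpret S0: prob_space "S 0" by (rule prob_S)
  show ?case using S0.prob_space by (simp add: bern_mean_0)
next
  case (Suc n)
  interpret SS: prob_space "S (Suc n)" by (rule prob_S)
  obtain c1 c2 where c: "\<And>X. \<bar>B n F X\<bar> \<le> c1" "\<And>X. \<bar>B n (\<lambda>m. F (Suc m)) X\<bar> \<le> c2" using B_bounded by metis
  have a1: "(\<integral>X. (1 - p (X n)) * B n F X \<partial>S (Suc n)) = (\<integral>x. 1 - p x \<partial>M) * (\<integral>X. B n F X \<partial>S n)"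
    using c p01 by (intro PiM_integral_Suc[of _ 1]) (auto intro: B_local B_meas)
  have a2: "(\<integral>X. p (X n) * B n (\<lambda>m. F (Suc m)) X \<partial>S (Suc n)) = mp * (\<integral>X. B n (\<lambda>m. F (Suc m)) X \<partial>S n)"
    using c p01 by (intro PiM_integral_Suc[of _ 1]) (auto intro: B_local B_meas)
  have i: "integrable M p" using p01 by (intro integrable_const_bound[of _ 1]) auto
  have b1: "\<bar>(1 - p (X n)) * B n F X\<bar> \<le> 1 * c1" for X unfolding abs_mult using c[of X] p01[of "X n"]
    by (intro mult_mono) auto
  have b2: "\<bar>p (X n) * B n (\<lambda>m. F (Suc m)) X\<bar> \<le> 1 * c2" for X unfolding abs_mult using c[of X] p01[of "X n"]
    by (intro mult_mono) auto
  have "(\<integral>X. B (Suc n) F X \<partial>S (Suc n)) = (\<integral>x. 1 - p x \<partial>M) * (\<integral>X. B n F X \<partial>S n) + mp * (\<integral>X. B n (\<lambda>m. F (Suc m)) X \<partial>S n)"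
    unfolding bern_mean_Suc a1[symmetric] a2[symmetric]
    using b1 b2 by (intro Bochner_Integration.integral_add SS.integrable_const_bound[of _ "1 * c1"] SS.integrable_const_bound[of _ "1 * c2"])
       (auto)
  thus ?case unfolding Suc bern_mean_Suc using i by (simp add: prob_space)
qed

text \<open>Efron--Stein for a function of the number of successes.\<close>

lemma B_variance:
  "(\<integral>X. (B (Suc n) F X - bern_mean (Suc n) (\<lambda>_. mp) F)\<^sup>2 \<partial>S (Suc n))
    \<le> Suc n * (\<integral>x. (p x)\<^sup>2 \<partial>M) * bern_mean n (\<lambda>_. mp) (\<lambda>m. (F (Suc m) - F m)\<^sup>2)"
proof -
  define v where "v = (\<integral>x. (p x - mp)\<^sup>2 \<partial>M)"
  have ip: "integrable M p" using p01 by (intro integrable_const_bound[of _ 1]) auto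
  have ip2: "integrable M (\<lambda>x. (p x)\<^sup>2)" using p01 by (intro integrable_const_bound[of _ 1]) (auto simp: power_le_one)
  have v0: "0 \<le> v" unfolding v_def by simp
  have v: "v \<le> (\<integral>x. (p x)\<^sup>2 \<partial>M)"
    unfolding v_def using ip ip2 by (subst variance_eq) auto
  define V where "V n F = (\<integral>X. (B n F X - bern_mean n (\<lambda>_. mp) F)\<^sup>2 \<partial>S n)" for n F
  \<comment> \<open>The fluctuation of the last point contributes at most \<open>v\<close> times the
    mean squared increment of \<open>F\<close>; the rest is dominated by a mixture of the variances
    for \<open>F\<close> and its shift.\<close>
  have step: "V (Suc n) F \<le> (1 - mp) * V n F + mp * V n (\<lambda>m. F (Suc m))
      + v * bern_mean n (\<lambda>_. mp) (\<lambda>m. (F (Suc m) - F m)\<^sup>2)" for n F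
  proof -
    interpret SS: prob_space "S (Suc n)" by (rule prob_S)
    interpret Sn: prob_space "S n" by (rule prob_S)
    let ?F' = "\<lambda>m. F (Suc m)" and ?D = "\<lambda>m. F (Suc m) - F m"
    let ?b = "\<lambda>F. bern_mean n (\<lambda>_. mp) F"
    define Z where "Z X = (1 - mp) * (B n F X - ?b F) + mp * (B n ?F' X - ?b ?F')" for X
    define Y where "Y X = B n ?D X" for X
    \<comment> \<open>\<open>Z\<close> and \<open>Y\<close> depend on the first \<open>n\<close>
      points only, and \<open>p (X n) - mp\<close> is centred and independent of them, which removes
      the cross term in \<open>I2\<close>.\<close>
    have dec: "B (Suc n) F X - bern_mean (Suc n) (\<lambda>_. mp) F = Z X + (p (X n) - mp) * Y X" for X
      unfolding Z_def Y_def bern_mean_Suc bern_mean_diff by (simp add: algebra_simps)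
    have [measurable]: "Z \<in> borel_measurable (S n)" "Z \<in> borel_measurable (S (Suc n))"
        "Y \<in> borel_measurable (S n)" "Y \<in> borel_measurable (S (Suc n))"
      unfolding Z_def Y_def by measurable
    have loc: "Z x = Z y" "Y x = Y y" if "\<And>i. i < n \<Longrightarrow> x i = y i" for x y
      unfolding Z_def Y_def using B_local[of n x y] that by auto
    have loc2: "(Z x)\<^sup>2 = (Z y)\<^sup>2" "(Y x)\<^sup>2 = (Y y)\<^sup>2" "Z x * Y x = Z y * Y y"
      if "\<And>i. i < n \<Longrightarrow> x i = y i" for x y
      using loc[OF that] by simp_all
    obtain c1 c2 c3 where c: "\<And>X. \<bar>B n F X\<bar> \<le> c1" "\<And>X. \<bar>B n ?F' X\<bar> \<le> c2" "\<And>X. \<bar>Y X\<bar> \<le> c3"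
      using B_bounded unfolding Y_def by metis
    define c4 where "c4 = (1 - mp) * (c1 + \<bar>?b F\<bar>) + mp * (c2 + \<bar>?b ?F'\<bar>)"
    have Zb: "\<bar>Z X\<bar> \<le> c4" for X
    proof -
      have "\<bar>Z X\<bar> \<le> \<bar>1 - mp\<bar> * \<bar>B n F X - ?b F\<bar> + \<bar>mp\<bar> * \<bar>B n ?F' X - ?b ?F'\<bar>"
        unfolding Z_def abs_mult[symmetric] by (rule abs_triangle_ineq)
      also have "\<dots> \<le> c4" unfolding c4_def using c[of X] mp01
        by (intro add_mono mult_mono) auto
      finally show ?thesis .
    qed
    have c4: "0 \<le> c4" and c3: "0 \<le> c3" using Zb c(3) abs_ge_zero order_trans by blast+
    have sq: "\<bar>(Z X)\<^sup>2\<bar> \<le> c4\<^sup>2" "\<bar>(Y X)\<^sup>2\<bar> \<le> c3\<^sup>2" "\<bar>Z X * Y X\<bar> \<le> c4 * c3" for X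
      using Zb[of X] c(3)[of X] c3 c4 power_mono[of "\<bar>Z X\<bar>" c4 2] power_mono[of "\<bar>Y X\<bar>" c3 2]
      by (auto simp: abs_mult intro!: mult_mono)
    have pb: "\<bar>p x - mp\<bar> \<le> 1" for x using p01[of x] mp01 by auto
    hence pb2: "\<bar>(p x - mp)\<^sup>2\<bar> \<le> 1" for x by (simp add: abs_square_le_1)
    have I1: "(\<integral>X. (Z X)\<^sup>2 \<partial>S (Suc n)) = (\<integral>X. (Z X)\<^sup>2 \<partial>S n)"
    proof -
      have "(\<integral>X. 1 * (Z X)\<^sup>2 \<partial>S (Suc n)) = (\<integral>x. 1 \<partial>M) * (\<integral>X. (Z X)\<^sup>2 \<partial>S n)"
        by (rule PiM_integral_Suc[where G = 1, OF _ _ _ sq(1) loc2(1)]) simp_all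
      thus ?thesis by (simp add: prob_space)
    qed
    have I2: "(\<integral>X. (p (X n) - mp) * (Z X * Y X) \<partial>S (Suc n)) = 0"
    proof -
      have "(\<integral>X. (p (X n) - mp) * (Z X * Y X) \<partial>S (Suc n)) = (\<integral>x. p x - mp \<partial>M) * (\<integral>X. Z X * Y X \<partial>S n)"
        by (rule PiM_integral_Suc[OF _ pb _ sq(3) loc2(3)]) simp_all
      thus ?thesis using ip by (simp add: prob_space)
    qed
    have I3: "(\<integral>X. (p (X n) - mp)\<^sup>2 * (Y X)\<^sup>2 \<partial>S (Suc n)) = v * (\<integral>X. (Y X)\<^sup>2 \<partial>S n)"
      unfolding v_def by (rule PiM_integral_Suc[OF _ pb2 _ sq(2) loc2(2)]) simp_all
    have i1: "integrable (S (Suc n)) (\<lambda>X. (Z X)\<^sup>2)"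
      using sq by (intro SS.integrable_const_bound[of _ "c4\<^sup>2"]) auto
    have i2: "integrable (S (Suc n)) (\<lambda>X. (p (X n) - mp) * (Z X * Y X))"
      using mult_mono[OF pb sq(3)] c3 c4 by (intro SS.integrable_const_bound[of _ "1 * (c4 * c3)"]) (auto simp: abs_mult)
    have i3: "integrable (S (Suc n)) (\<lambda>X. (p (X n) - mp)\<^sup>2 * (Y X)\<^sup>2)"
      using mult_mono[OF pb2 sq(2)] by (intro SS.integrable_const_bound[of _ "1 * c3\<^sup>2"]) (auto simp: abs_mult)
    have "V (Suc n) F = (\<integral>X. (Z X)\<^sup>2 + 2 * ((p (X n) - mp) * (Z X * Y X)) + (p (X n) - mp)\<^sup>2 * (Y X)\<^sup>2 \<partial>S (Suc n))"
      unfolding V_def dec by (intro Bochner_Integration.integral_cong refl) (simp add: power2_eq_square algebra_simps)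
    also have "\<dots> = (\<integral>X. (Z X)\<^sup>2 \<partial>S n) + v * (\<integral>X. (Y X)\<^sup>2 \<partial>S n)"
      using i1 i2 i3 by (simp add: I1 I2 I3)
    also have "\<dots> \<le> ((1 - mp) * V n F + mp * V n ?F') + v * ?b (\<lambda>m. (?D m)\<^sup>2)"
    proof (rule add_mono)
      have j: "integrable (S n) (\<lambda>X. (B n G X - ?b G)\<^sup>2)" for G
      proof -
        obtain c where c: "\<And>X. \<bar>B n G X\<bar> \<le> c" using B_bounded by metis
        have "\<bar>B n G X - ?b G\<bar> \<le> c + \<bar>?b G\<bar>" for X using c[of X] by linarith
        hence "(B n G X - ?b G)\<^sup>2 \<le> (c + \<bar>?b G\<bar>)\<^sup>2" for X
          using power_mono[of "\<bar>B n G X - ?b G\<bar>" _ 2] by simp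
        thus ?thesis by (intro Sn.integrable_const_bound[of _ "(c + \<bar>?b G\<bar>)\<^sup>2"]) auto
      qed
      have "(\<integral>X. (Z X)\<^sup>2 \<partial>S n) \<le> (\<integral>X. (1 - mp) * (B n F X - ?b F)\<^sup>2 + mp * (B n ?F' X - ?b ?F')\<^sup>2 \<partial>S n)"
      proof (rule integral_mono)
        show "integrable (S n) (\<lambda>X. (Z X)\<^sup>2)"
          using sq(1) by (intro Sn.integrable_const_bound[of _ "c4\<^sup>2"]) auto
        show "integrable (S n) (\<lambda>X. (1 - mp) * (B n F X - ?b F)\<^sup>2 + mp * (B n ?F' X - ?b ?F')\<^sup>2)"
          using j[of F] j[of ?F'] by simp
        show "(Z X)\<^sup>2 \<le> (1 - mp) * (B n F X - ?b F)\<^sup>2 + mp * (B n ?F' X - ?b ?F')\<^sup>2" for X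
          unfolding Z_def by (rule convex_combination_square[OF mp01])
      qed
      also have "\<dots> = (1 - mp) * V n F + mp * V n ?F'"
        unfolding V_def using j[of F] j[of ?F'] by simp
      finally show "(\<integral>X. (Z X)\<^sup>2 \<partial>S n) \<le> (1 - mp) * V n F + mp * V n ?F'" .
      obtain c where c: "\<And>X. \<bar>B n (\<lambda>m. (?D m)\<^sup>2) X\<bar> \<le> c" using B_bounded by metis
      have "(\<integral>X. (Y X)\<^sup>2 \<partial>S n) \<le> (\<integral>X. B n (\<lambda>m. (?D m)\<^sup>2) X \<partial>S n)"
      proof (rule integral_mono)
        show "integrable (S n) (\<lambda>X. (Y X)\<^sup>2)"
          using sq(2) by (intro Sn.integrable_const_bound[of _ "c3\<^sup>2"]) auto
        show "integrable (S n) (B n (\<lambda>m. (?D m)\<^sup>2))"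
          using c by (intro Sn.integrable_const_bound[of _ c]) auto
        show "(Y X)\<^sup>2 \<le> B n (\<lambda>m. (?D m)\<^sup>2) X" for X
          unfolding Y_def by (rule bern_mean_square_le) (simp add: p01)
      qed
      thus "v * (\<integral>X. (Y X)\<^sup>2 \<partial>S n) \<le> v * ?b (\<lambda>m. (?D m)\<^sup>2)"
        unfolding B_integral by (rule mult_left_mono[OF _ v0])
    qed
    finally show ?thesis .
  qed
  have V0: "V 0 F = 0" for F by (simp add: V_def bern_mean_0)
  have "V (Suc n) F \<le> Suc n * v * bern_mean n (\<lambda>_. mp) (\<lambda>m. (F (Suc m) - F m)\<^sup>2)" for n F
  proof (induction n arbitrary: F)
    case 0 show ?case using step[of 0 F] by (simp add: V0)
  next
    case (Suc n)
    let ?q = "\<lambda>F. bern_mean n (\<lambda>_. mp) (\<lambda>m. (F (Suc m) - F m)\<^sup>2)"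
    \<comment> \<open>By \<open>bern_mean_Suc\<close> the mixture of the two induction bounds has
      the same form as the new term, so the count rises by one.\<close>
    have "V (Suc (Suc n)) F \<le> (1 - mp) * (Suc n * v * ?q F) + mp * (Suc n * v * ?q (\<lambda>m. F (Suc m)))
      + v * bern_mean (Suc n) (\<lambda>_. mp) (\<lambda>m. (F (Suc m) - F m)\<^sup>2)"
      using step[of "Suc n" F] mult_left_mono[OF Suc[of F], of "1 - mp"]
        mult_left_mono[OF Suc[of "\<lambda>m. F (Suc m)"], of mp] mp01 by linarith
    also have "\<dots> = Suc (Suc n) * v * bern_mean (Suc n) (\<lambda>_. mp) (\<lambda>m. (F (Suc m) - F m)\<^sup>2)"
      unfolding bern_mean_Suc by (simp add: algebra_simps)
    finally show ?case .
  qed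
  from this[of n F] have "V (Suc n) F \<le> Suc n * v * bern_mean n (\<lambda>_. mp) (\<lambda>m. (F (Suc m) - F m)\<^sup>2)" .
  also have "\<dots> \<le> Suc n * (\<integral>x. (p x)\<^sup>2 \<partial>M) * bern_mean n (\<lambda>_. mp) (\<lambda>m. (F (Suc m) - F m)\<^sup>2)"
    using v mp01 by (intro mult_right_mono mult_left_mono bern_mean_nonneg) simp_all
  finally show ?thesis unfolding V_def .
qed

end

section \<open>Score correlation and block reflections\<close>

lemma normal_density_shift:
  "normal_density (m + t) 1 x = normal_density m 1 x * exp (t * (x - m) - t\<^sup>2 / 2)"
proof -
  have "- (x - (m + t))\<^sup>2 / 2 = - (x - m)\<^sup>2 / 2 + (t * (x - m) - t\<^sup>2 / 2)"
    by (simp add: power2_eq_square field_simps)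
  thus ?thesis unfolding normal_density_def by (simp add: exp_add[symmetric])
qed

lemma normal_density_reflect: "normal_density m 1 (2 * c - x) = normal_density (2 * c - m) 1 x"
proof -
  have "(2 * c - x - m)\<^sup>2 = (x - (2 * c - m))\<^sup>2"
    by (simp add: power2_eq_square algebra_simps)
  thus ?thesis by (simp add: normal_density_def)
qed

lemma integral_gauss_entry:
  fixes h :: "real \<Rightarrow> real"
  assumes j: "j < d" and [measurable]: "h \<in> borel_measurable borel"
  shows "(\<integral>x. h (x j) \<partial>gauss d \<mu>) = (\<integral>x. normal_density (\<mu> j) 1 x * h x \<partial>lborel)"
    and "integrable (gauss d \<mu>) (\<lambda>x. h (x j)) = integrable lborel (\<lambda>x. normal_density (\<mu> j) 1 x * h x)"
proof -
  let ?N = "density lborel (\<lambda>x. ennreal (normal_density (\<mu> j) 1 x))"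
  have d: "distr (gauss d \<mu>) ?N (\<lambda>x. x j) = ?N"
    unfolding gauss_def using j by (intro distr_PiM_component prob_space_normal_density) auto
  have m: "(\<lambda>x. x j) \<in> measurable (gauss d \<mu>) ?N"
    unfolding gauss_def using j by (intro measurable_component_singleton) auto
  show "(\<integral>x. h (x j) \<partial>gauss d \<mu>) = (\<integral>x. normal_density (\<mu> j) 1 x * h x \<partial>lborel)"
    using integral_distr[OF m, of h] by (simp add: d integral_density)
  show "integrable (gauss d \<mu>) (\<lambda>x. h (x j)) = integrable lborel (\<lambda>x. normal_density (\<mu> j) 1 x * h x)"
    using integrable_distr_eq[OF m, of h] by (simp add: d integrable_density)
qed

lemma integral_sample_row:
  fixes h :: "(nat \<Rightarrow> real) \<Rightarrow> real"
  assumes i: "i < n" and [measurable]: "h \<in> borel_measurable (gauss d \<mu>)"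
  shows "(\<integral>X. h (X i) \<partial>sample d n \<mu>) = (\<integral>x. h x \<partial>gauss d \<mu>)"
    and "integrable (sample d n \<mu>) (\<lambda>X. h (X i)) = integrable (gauss d \<mu>) h"
proof -
  have d: "distr (sample d n \<mu>) (gauss d \<mu>) (\<lambda>X. X i) = gauss d \<mu>"
    unfolding sample_def using i by (intro distr_PiM_component prob_space_gauss) auto
  have m: "(\<lambda>X. X i) \<in> measurable (sample d n \<mu>) (gauss d \<mu>)"
    unfolding sample_def using i by (intro measurable_component_singleton) auto
  show "(\<integral>X. h (X i) \<partial>sample d n \<mu>) = (\<integral>x. h x \<partial>gauss d \<mu>)"
    using integral_distr[OF m, of h] by (simp add: d)
  show "integrable (sample d n \<mu>) (\<lambda>X. h (X i)) = integrable (gauss d \<mu>) h"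
    using integrable_distr_eq[OF m, of h] by (simp add: d)
qed

lemma measurable_gauss_entry: "j < d \<Longrightarrow> (\<lambda>x. x j) \<in> borel_measurable (gauss d \<mu>)"
proof -
  assume "j < d"
  hence "(\<lambda>x. x j) \<in> measurable (gauss d \<mu>) (density lborel (\<lambda>x. ennreal (normal_density (\<mu> j) 1 x)))"
    unfolding gauss_def by (intro measurable_component_singleton) auto
  thus ?thesis by simp
qed

text \<open>The centre \<open>c\<close> is arbitrary because flip probabilities are controlled by
  the distance to the midpoint of two means.\<close>

lemma gauss_moments:
  assumes j: "j < d"
  shows "integrable (gauss d \<mu>) (\<lambda>x. x j - \<mu> j)" "(\<integral>x. x j - \<mu> j \<partial>gauss d \<mu>) = 0"
    "integrable (gauss d \<mu>) (\<lambda>x. (x j - c)\<^sup>2)" "(\<integral>x. (x j - c)\<^sup>2 \<partial>gauss d \<mu>) = 1 + (\<mu> j - c)\<^sup>2"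
proof -
  interpret prob_space "gauss d \<mu>" by (rule prob_space_gauss)
  note e1 = integral_gauss_entry[OF j, of "\<lambda>x. x - \<mu> j" \<mu>]
  note e2 = integral_gauss_entry[OF j, of "\<lambda>x. (x - \<mu> j)\<^sup>2" \<mu>]
  show 1: "integrable (gauss d \<mu>) (\<lambda>x. x j - \<mu> j)" "(\<integral>x. x j - \<mu> j \<partial>gauss d \<mu>) = 0"
    using e1 integral_normal_moment_odd[of 1 "\<mu> j" 0] integrable_normal_moment[of 1 "\<mu> j" 1] by simp_all
  have 2: "integrable (gauss d \<mu>) (\<lambda>x. (x j - \<mu> j)\<^sup>2)" "(\<integral>x. (x j - \<mu> j)\<^sup>2 \<partial>gauss d \<mu>) = 1"
    using e2 integral_normal_moment_even[of 1 "\<mu> j" 1] integrable_normal_moment[of 1 "\<mu> j" 2]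
    by (simp_all add: fact_numeral)
  have eq: "(\<lambda>x. (x j - c)\<^sup>2) = (\<lambda>x. (x j - \<mu> j)\<^sup>2 + 2 * (\<mu> j - c) * (x j - \<mu> j) + (\<mu> j - c)\<^sup>2)"
    by (simp add: fun_eq_iff power2_eq_square algebra_simps)
  show "integrable (gauss d \<mu>) (\<lambda>x. (x j - c)\<^sup>2)" "(\<integral>x. (x j - c)\<^sup>2 \<partial>gauss d \<mu>) = 1 + (\<mu> j - c)\<^sup>2"
    unfolding eq using 1 2 prob_space by simp_all
qed

lemma entry_moments:
  assumes "i < n" "j < d"
  shows "integrable (sample d n \<mu>) (\<lambda>X. X i j - \<mu> j)" "(\<integral>X. X i j - \<mu> j \<partial>sample d n \<mu>) = 0"
    "integrable (sample d n \<mu>) (\<lambda>X. (X i j - \<mu> j)\<^sup>2)" "(\<integral>X. (X i j - \<mu> j)\<^sup>2 \<partial>sample d n \<mu>) = 1"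
proof -
  have [measurable]: "(\<lambda>x. x j) \<in> borel_measurable (gauss d \<mu>)"
    using assms by (intro measurable_gauss_entry)
  note r1 = integral_sample_row[OF assms(1), of "\<lambda>x. x j - \<mu> j" d \<mu>]
  note r2 = integral_sample_row[OF assms(1), of "\<lambda>x. (x j - \<mu> j)\<^sup>2" d \<mu>]
  show "integrable (sample d n \<mu>) (\<lambda>X. X i j - \<mu> j)" "(\<integral>X. X i j - \<mu> j \<partial>sample d n \<mu>) = 0"
    "integrable (sample d n \<mu>) (\<lambda>X. (X i j - \<mu> j)\<^sup>2)" "(\<integral>X. (X i j - \<mu> j)\<^sup>2 \<partial>sample d n \<mu>) = 1"
    using r1 r2 gauss_moments(1,2)[OF assms(2), of \<mu>] gauss_moments(3,4)[OF assms(2), of \<mu> "\<mu> j"]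
    by simp_all
qed

lemma dens_reflect: "dens d n \<mu> (reflect d n T \<mu> X) = dens d n \<mu> X"
  unfolding dens_def by (intro prod.cong refl) (simp add: reflect_apply normal_density_reflect)

text \<open>For \<open>K = {..<n}\<close> this is the derivative of the log-likelihood with respect
  to \<open>\<mu> j\<close>; for a smaller \<open>K\<close> it is the share of the points in
  \<open>K\<close>.\<close>

definition score :: "(nat \<Rightarrow> real) \<Rightarrow> nat set \<Rightarrow> nat \<Rightarrow> (nat \<Rightarrow> nat \<Rightarrow> real) \<Rightarrow> real" where
  "score \<mu> K j X = (\<Sum>i\<in>K. X i j - \<mu> j)"

lemma measurable_score: "K \<subseteq> {..<n} \<Longrightarrow> j < d \<Longrightarrow> score \<mu> K j \<in> borel_measurable (data_borel d n)"
proof -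
  assume K: "K \<subseteq> {..<n}" and [simp]: "j < d"
  have "(\<lambda>X. X i j) \<in> borel_measurable (data_borel d n)" if "i \<in> K" for i
    using K that by (intro measurable_entry) auto
  thus ?thesis unfolding score_def[abs_def] by (intro borel_measurable_sum borel_measurable_diff) auto
qed

lemma score_moments:
  assumes K: "K \<subseteq> {..<n}" and j: "j < d"
  shows "integrable (sample d n \<mu>) (score \<mu> K j)" "(\<integral>X. score \<mu> K j X \<partial>sample d n \<mu>) = 0"
    "integrable (sample d n \<mu>) (\<lambda>X. (score \<mu> K j X)\<^sup>2)"
    "(\<integral>X. (score \<mu> K j X)\<^sup>2 \<partial>sample d n \<mu>) = card K"
proof -
  have Kn: "\<And>i. i \<in> K \<Longrightarrow> i < n" using K by auto
  have [measurable]: "(\<lambda>X. X i j) \<in> borel_measurable (data_borel d n)" if "i \<in> K" for i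
    using K that j by (intro measurable_entry) auto
  have fin: "finite K" using K finite_subset by blast
  note em = entry_moments[OF Kn j, of _ \<mu>]
  show "integrable (sample d n \<mu>) (score \<mu> K j)" "(\<integral>X. score \<mu> K j X \<partial>sample d n \<mu>) = 0"
    using em by (simp_all add: score_def[abs_def])
  have int: "integrable (sample d n \<mu>) (\<lambda>X. (X i j - \<mu> j) * (X i' j - \<mu> j))" if "i \<in> K" "i' \<in> K" for i i'
    using that em by (intro Cauchy_Schwarz_integral) (auto simp: measurable_sample_iff)
  have val: "(\<integral>X. (X i j - \<mu> j) * (X i' j - \<mu> j) \<partial>sample d n \<mu>) = (if i = i' then 1 else 0)"
    if "i \<in> K" "i' \<in> K" for i i'
  proof (cases "i = i'")
    case True thus ?thesis using that em by (simp add: power2_eq_square[symmetric])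
  next
    case False
    let ?h = "\<lambda>X::nat \<Rightarrow> nat \<Rightarrow> real. (X i j - \<mu> j) * (X i' j - \<mu> j)"
    have [measurable]: "?h \<in> borel_measurable (data_borel d n)" using that by measurable
    \<comment> \<open>Reflecting the single entry \<open>(i, j)\<close> about its mean keeps the law
      and changes the sign of the product, so the mixed moment equals its own negative. The factor
      \<open>1\<close> is the weight in \<open>integral_reflect\<close>.\<close>
    have "(\<integral>X. ?h X * 1 \<partial>sample d n \<mu>) = (\<integral>X. ?h (reflect d n {(i, j)} \<mu> X) * 1 \<partial>sample d n \<mu>)"
      by (intro integral_reflect) (auto simp: dens_reflect)
    also have "\<dots> = - (\<integral>X. ?h X \<partial>sample d n \<mu>)"
      unfolding integral_minus[symmetric] using that Kn j False
      by (intro Bochner_Integration.integral_cong refl) (simp add: reflect_apply algebra_simps)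
    finally show ?thesis using False by simp
  qed
  have sq: "(score \<mu> K j X)\<^sup>2 = (\<Sum>i\<in>K. \<Sum>i'\<in>K. (X i j - \<mu> j) * (X i' j - \<mu> j))" for X
    unfolding score_def power2_eq_square sum_product ..
  show "integrable (sample d n \<mu>) (\<lambda>X. (score \<mu> K j X)\<^sup>2)"
    unfolding sq using int by auto
  show "(\<integral>X. (score \<mu> K j X)\<^sup>2 \<partial>sample d n \<mu>) = card K"
    unfolding sq using int val fin by simp
qed

text \<open>Likelihood ratio: only factor \<open>j\<close> of each row changes, and the exponents of
  the rows add up to the score.\<close>

lemma dens_shift:
  assumes "j < d"
  shows "dens d n (\<mu>(j := \<mu> j + t)) X = dens d n \<mu> X * exp (t * score \<mu> {..<n} j X - n * t\<^sup>2 / 2)"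
proof -
  have "(\<Prod>j'<d. normal_density ((\<mu>(j := \<mu> j + t)) j') 1 (X i j'))
     = (\<Prod>j'<d. normal_density (\<mu> j') 1 (X i j')) * exp (t * (X i j - \<mu> j) - t\<^sup>2 / 2)" for i
  proof -
    have "(\<Prod>j'<d. normal_density ((\<mu>(j := \<mu> j + t)) j') 1 (X i j'))
      = (\<Prod>j'<d. normal_density (\<mu> j') 1 (X i j') * (if j' = j then exp (t * (X i j - \<mu> j) - t\<^sup>2 / 2) else 1))"
      by (intro prod.cong refl) (auto simp: normal_density_shift)
    thus ?thesis using assms by (simp add: prod.distrib)
  qed
  moreover have "(\<Prod>i<n. exp (t * (X i j - \<mu> j) - t\<^sup>2 / 2)) = exp (t * score \<mu> {..<n} j X - n * t\<^sup>2 / 2)"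
    by (simp add: exp_sum[symmetric] score_def sum_subtractf sum_distrib_left[symmetric])
  ultimately show ?thesis unfolding dens_def by (simp add: prod.distrib)
qed

lemma integral_shift:
  fixes h :: "_ \<Rightarrow> real"
  assumes j: "j < d" and [measurable]: "h \<in> borel_measurable (data_borel d n)"
  shows "(\<integral>X. exp (t * score \<mu> {..<n} j X - n * t\<^sup>2 / 2) * h X \<partial>sample d n \<mu>)
      = (\<integral>X. h X \<partial>sample d n (\<mu>(j := \<mu> j + t)))"
    and "integrable (sample d n \<mu>) (\<lambda>X. exp (t * score \<mu> {..<n} j X - n * t\<^sup>2 / 2) * h X)
      = integrable (sample d n (\<mu>(j := \<mu> j + t))) h"
proof -
  have [measurable]: "score \<mu> {..<n} j \<in> borel_measurable (data_borel d n)"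
    using j by (intro measurable_score) auto
  show "(\<integral>X. exp (t * score \<mu> {..<n} j X - n * t\<^sup>2 / 2) * h X \<partial>sample d n \<mu>)
      = (\<integral>X. h X \<partial>sample d n (\<mu>(j := \<mu> j + t)))"
    "integrable (sample d n \<mu>) (\<lambda>X. exp (t * score \<mu> {..<n} j X - n * t\<^sup>2 / 2) * h X)
      = integrable (sample d n (\<mu>(j := \<mu> j + t))) h"
    by (simp_all add: integral_sample dens_shift[OF j] mult.assoc)
qed

text \<open>\<open>E\<close> is the remainder of the likelihood ratio after its first-order
  expansion in \<open>t\<close>. Its second moment is exactly \<open>exp x - 1 - x\<close> with
  \<open>x = n * t\<^sup>2\<close>, which is at most \<open>x\<^sup>2\<close> for
  \<open>x \<le> 1\<close>.\<close>

lemma likelihood_linearization: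
  fixes \<mu> :: "nat \<Rightarrow> real"
  assumes j: "j < d" and t: "n * t\<^sup>2 \<le> 1"
  defines "E \<equiv> \<lambda>X. exp (t * score \<mu> {..<n} j X - n * t\<^sup>2 / 2) - 1 - t * score \<mu> {..<n} j X"
  shows "integrable (sample d n \<mu>) (\<lambda>X. (E X)\<^sup>2)" "(\<integral>X. (E X)\<^sup>2 \<partial>sample d n \<mu>) \<le> (n * t\<^sup>2)\<^sup>2"
proof -
  let ?W = "score \<mu> {..<n} j" and ?P = "sample d n \<mu>"
  let ?L = "\<lambda>(s::real) X. exp (s * ?W X - n * s\<^sup>2 / 2)"
  let ?x = "n * t\<^sup>2"
  interpret P: prob_space ?P by (rule prob_space_sample)
  interpret Q: prob_space "sample d n (\<mu>(j := \<mu> j + s))" for s by (rule prob_space_sample)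
  have [measurable]: "?W \<in> borel_measurable (data_borel d n)"
    using j by (intro measurable_score) auto
  have L: "integrable ?P (?L s)" "(\<integral>X. ?L s X \<partial>?P) = 1" for s
    using integral_shift[OF j, of "\<lambda>_. 1" n \<mu> s] Q.prob_space by simp_all
  \<comment> \<open>The square of the likelihood ratio for \<open>t\<close> is the one for
    \<open>2 * t\<close> up to a constant factor, and likelihood ratios integrate to one.\<close>
  have L2: "(?L t X)\<^sup>2 = exp ?x * ?L (2 * t) X" for X
    by (simp add: exp_add[symmetric] exp_double[symmetric] power2_eq_square algebra_simps)
  \<comment> \<open>Under the shifted law the score has mean \<open>n * t\<close>; this yields the
    mixed moment \<open>LW\<close>.\<close>
  have W: "?W X = score (\<mu>(j := \<mu> j + t)) {..<n} j X + n * t" for X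
    by (simp add: score_def sum_subtractf sum.distrib algebra_simps)
  note sm = score_moments[of "{..<n}" n j d \<mu>, OF _ j]
  note sm' = score_moments[of "{..<n}" n j d "\<mu>(j := \<mu> j + t)", OF _ j]
  have "integrable (sample d n (\<mu>(j := \<mu> j + t))) ?W" "(\<integral>X. ?W X \<partial>sample d n (\<mu>(j := \<mu> j + t))) = n * t"
    unfolding W using sm' Q.prob_space[of t] by simp_all
  hence LW: "integrable ?P (\<lambda>X. ?L t X * ?W X)" "(\<integral>X. ?L t X * ?W X \<partial>?P) = n * t"
    using integral_shift[OF j, of ?W n \<mu> t] by simp_all
  have exp: "(E X)\<^sup>2 = exp ?x * ?L (2 * t) X + 1 + t\<^sup>2 * (?W X)\<^sup>2 - 2 * ?L t X - 2 * t * (?L t X * ?W X) + 2 * t * ?W X" for X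
    unfolding E_def L2[symmetric] by (simp add: power2_eq_square algebra_simps)
  show "integrable ?P (\<lambda>X. (E X)\<^sup>2)"
    unfolding exp using L(1)[of t] L(1)[of "2 * t"] LW(1) sm(1,3) by simp
  have "(\<integral>X. (E X)\<^sup>2 \<partial>?P) = exp ?x + 1 + t\<^sup>2 * n - 2 - 2 * t * (n * t)"
    unfolding exp using L[of t] L[of "2 * t"] LW sm P.prob_space by simp
  also have "\<dots> = exp ?x - 1 - ?x" by (simp add: power2_eq_square)
  also have "\<dots> \<le> ?x\<^sup>2" using exp_bound[of ?x] t by simp
  finally show "(\<integral>X. (E X)\<^sup>2 \<partial>?P) \<le> ?x\<^sup>2" .
qed

text \<open>Averaging over a grid of side \<open>M\<close>, the increments telescope along each axis and the bounded bias
  contributes only at the two ends.\<close>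

lemma exists_large_divergence:
  fixes m :: "nat \<Rightarrow> (nat \<Rightarrow> real) \<Rightarrow> real"
  assumes t: "0 < t" and b: "\<And>j \<mu>. j < d \<Longrightarrow> \<bar>m j \<mu> - \<mu> j\<bar> \<le> b"
  shows "\<exists>\<mu>. 3 / 4 * d * t \<le> (\<Sum>j<d. m j (\<mu>(j := \<mu> j + t)) - m j \<mu>)"
proof (rule ccontr)
  assume "\<not> ?thesis"
  hence less: "(\<Sum>j<d. m j (\<mu>(j := \<mu> j + t)) - m j \<mu>) < 3 / 4 * d * t" for \<mu>
    by (auto simp: not_le)
  \<comment> \<open>Chosen so that the bias \<open>b\<close> at both ends costs at most a quarter of
    the length \<open>M * t\<close> of a grid line, which leaves the factor 3/4.\<close>
  obtain M0 :: nat where M0: "8 * b / t < M0" using reals_Archimedean2 by blast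
  define M where "M = Suc M0"
  have M: "2 * b \<le> M * t / 4" "M > 0"
    using M0 t by (auto simp: M_def field_simps)
  define G where "G I = Pi\<^sub>E I (\<lambda>_. {..<M})" for I :: "nat set"
  define pt where "pt g = (\<lambda>j. t * real (g j))" for g :: "nat \<Rightarrow> nat"
  have axis: "3 / 4 * t * real M ^ d \<le> (\<Sum>g\<in>G {..<d}. m j ((pt g)(j := pt g j + t)) - m j (pt g))" if j: "j < d" for j
  proof -
    let ?I = "{..<d} - {j}"
    let ?D = "\<lambda>g. m j (pt (g(j := Suc (g j)))) - m j (pt g)"
    have pt_Suc: "(pt g)(j := pt g j + t) = pt (g(j := Suc (g j)))" for g
      by (auto simp: pt_def fun_eq_iff algebra_simps)
    have ins: "{..<d} = insert j ?I" using j by auto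
    \<comment> \<open>Coordinate \<open>j\<close> is separated from the others, so the sum over the
      grid becomes a sum over lines parallel to axis \<open>j\<close>.\<close>
    have "(\<Sum>g\<in>G {..<d}. ?D g) = (\<Sum>g\<in>(\<lambda>(y, g). g(j := y)) ` ({..<M} \<times> G ?I). ?D g)"
      unfolding G_def by (subst ins, subst PiE_insert_eq) simp
    also have "\<dots> = (\<Sum>(y, g)\<in>{..<M} \<times> G ?I. ?D (g(j := y)))"
      unfolding G_def using inj_combinator[of j ?I "\<lambda>_. {..<M}"]
      by (subst sum.reindex) (simp_all add: case_prod_unfold comp_def)
    also have "\<dots> = (\<Sum>g\<in>G ?I. \<Sum>y<M. ?D (g(j := y)))"
      by (simp add: sum.cartesian_product[symmetric] sum.swap[of _ _ "{..<M}"])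
    also have "\<dots> = (\<Sum>g\<in>G ?I. m j (pt (g(j := M))) - m j (pt (g(j := 0))))"
      by (simp add: sum_lessThan_telescope[where f="\<lambda>y. m j (pt (_(j := y)))"])
    also have "\<dots> \<ge> (\<Sum>g\<in>G ?I. M * t - 2 * b)"
    proof (rule sum_mono)
      fix g
      show "M * t - 2 * b \<le> m j (pt (g(j := M))) - m j (pt (g(j := 0)))"
        using b[OF j, of "pt (g(j := M))"] b[OF j, of "pt (g(j := 0))"] by (simp add: pt_def abs_le_iff algebra_simps)
    qed
    moreover have "(\<Sum>g\<in>G ?I. M * t - 2 * b) = real M ^ (d - 1) * (M * t - 2 * b)"
      using j by (simp add: G_def card_PiE)
    moreover have "real M ^ (d - 1) * (3 / 4 * t * M) \<le> real M ^ (d - 1) * (M * t - 2 * b)"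
      using M(1) by (intro mult_left_mono) (auto simp: algebra_simps)
    moreover have "real M ^ (d - 1) * (3 / 4 * t * M) = 3 / 4 * t * real M ^ d"
      using j by (cases d) auto
    ultimately show ?thesis unfolding pt_Suc by linarith
  qed
  have fin: "finite (G {..<d})" unfolding G_def by (intro finite_PiE) auto
  have card: "card (G {..<d}) = M ^ d" by (simp add: G_def card_PiE)
  have "d * (3 / 4 * t * real M ^ d) \<le> (\<Sum>j<d. \<Sum>g\<in>G {..<d}. m j ((pt g)(j := pt g j + t)) - m j (pt g))"
    using sum_mono[of "{..<d}" "\<lambda>_. 3 / 4 * t * real M ^ d", OF axis] by simp
  also have "\<dots> = (\<Sum>g\<in>G {..<d}. \<Sum>j<d. m j ((pt g)(j := pt g j + t)) - m j (pt g))"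
    by (rule sum.swap)
  \<comment> \<open>Strictness survives the summation because \<open>M > 0\<close> makes the grid
    nonempty.\<close>
  also have "\<dots> < (\<Sum>g\<in>G {..<d}. 3 / 4 * d * t)"
    using fin card M(2) by (intro sum_strict_mono less) auto
  finally show False by (simp add: card algebra_simps)
qed

text \<open>The setting of the lower bound at a fixed \<open>\<eta>\<close>, with
  \<open>\<sigma>\<close> a real bound on the sensitivity at all means. \<open>f_stab\<close> states
  it in squared form, which avoids \<open>ennsqrt\<close>.\<close>

locale stable_estimator =
  fixes d n :: nat and f :: "(nat \<Rightarrow> nat \<Rightarrow> real) \<Rightarrow> nat \<Rightarrow> real" and C \<eta> \<sigma> :: real and k :: nat
  assumes d: "1 \<le> d" and k: "1 \<le> k" "k \<le> n" and k_eq: "k = nat \<lfloor>\<eta> * real n\<rfloor>"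
    and C: "0 < C" and \<sigma>: "0 \<le> \<sigma>"
    and f_meas: "estimator_measurable d n f"
    and f_acc: "unif_MSE_accurate C d n f"
    and f_stab: "\<And>\<mu>. (\<integral>\<^sup>+ X. (emp_sens d n f \<eta> X)\<^sup>2 \<partial>sample d n \<mu>) \<le> ennreal (\<sigma>\<^sup>2)"
begin

abbreviation "P \<mu> \<equiv> sample d n \<mu>"
abbreviation "D \<equiv> data_borel d n"

lemma n_ge_1: "1 \<le> n" using k by simp

lemma f_measurable[measurable]: "j < d \<Longrightarrow> (\<lambda>X. f X j) \<in> borel_measurable D"
  using f_meas by (simp add: estimator_measurable_def)

lemma measurable_dist[measurable]:
  assumes [measurable]: "g \<in> measurable D D"
  shows "(\<lambda>X. dist_d d (f X) (f (g X))) \<in> borel_measurable D"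
proof -
  have "(\<lambda>X. f (g X) j) \<in> borel_measurable D" if "j < d" for j
    using measurable_compose[OF assms f_measurable[OF that]] .
  thus ?thesis unfolding dist_d_def
    by (intro measurable_compose[OF _ borel_measurable_sqrt] borel_measurable_sum borel_measurable_power
          borel_measurable_diff f_measurable) simp_all
qed

definition rmse :: real where "rmse = sqrt (C * d / n)"

lemma rmse_nonneg: "0 \<le> rmse" using C by (simp add: rmse_def)

lemma mse:
  assumes j: "j < d"
  shows "integrable (P \<mu>) (\<lambda>X. (f X j - \<mu> j)\<^sup>2)" "(\<integral>X. (f X j - \<mu> j)\<^sup>2 \<partial>P \<mu>) \<le> rmse\<^sup>2"
proof -
  have [measurable]: "(\<lambda>X. f X j) \<in> borel_measurable (P \<mu>)"
    using j by (simp add: measurable_sample_iff)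
  have "(\<integral>\<^sup>+X. ennreal ((f X j - \<mu> j)\<^sup>2) \<partial>P \<mu>) \<le> (\<integral>\<^sup>+X. ennreal ((dist_d d (f X) \<mu>)\<^sup>2) \<partial>P \<mu>)"
  proof (intro nn_integral_mono ennreal_leI)
    fix X
    have "(f X j - \<mu> j)\<^sup>2 \<le> (\<Sum>j<d. (f X j - \<mu> j)\<^sup>2)"
      using j by (intro member_le_sum) auto
    thus "(f X j - \<mu> j)\<^sup>2 \<le> (dist_d d (f X) \<mu>)\<^sup>2"
      by (simp add: dist_d_def sum_nonneg)
  qed
  also have "\<dots> \<le> ennreal (C * real d / real n)"
    using f_acc by (auto simp: unif_MSE_accurate_def)
  finally have le: "(\<integral>\<^sup>+X. ennreal ((f X j - \<mu> j)\<^sup>2) \<partial>P \<mu>) \<le> ennreal (C * real d / real n)" .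
  thus int: "integrable (P \<mu>) (\<lambda>X. (f X j - \<mu> j)\<^sup>2)"
    by (intro integrableI_bounded) (auto intro: le_less_trans)
  have "ennreal (\<integral>X. (f X j - \<mu> j)\<^sup>2 \<partial>P \<mu>) \<le> ennreal (C * real d / real n)"
    using le int by (simp add: nn_integral_eq_integral)
  thus "(\<integral>X. (f X j - \<mu> j)\<^sup>2 \<partial>P \<mu>) \<le> rmse\<^sup>2"
    using C by (simp add: rmse_def ennreal_le_iff)
qed

definition m :: "nat \<Rightarrow> (nat \<Rightarrow> real) \<Rightarrow> real" where "m j \<mu> = (\<integral>X. f X j \<partial>P \<mu>)"

lemma f_integrable:
  assumes j: "j < d" shows "integrable (P \<mu>) (\<lambda>X. f X j)"
proof -
  interpret prob_space "P \<mu>" by (rule prob_space_sample)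
  have "integrable (P \<mu>) (\<lambda>X. f X j - \<mu> j)"
    using mse[OF j, of \<mu>] j by (rule_tac square_integrable_imp_integrable) (simp_all add: measurable_sample_iff)
  from Bochner_Integration.integrable_add[OF this, of "\<lambda>_. \<mu> j"] show ?thesis by simp
qed

text \<open>The form in which accuracy enters: the correlation of any \<open>g\<close> with the
  error of \<open>f\<close> is at most \<open>rmse\<close> times the root mean square of
  \<open>g\<close>.\<close>

lemma covariance_bound:
  assumes j: "j < d" and [measurable]: "g \<in> borel_measurable D" and g2: "integrable (P \<mu>) (\<lambda>X. (g X)\<^sup>2)"
    and v: "(\<integral>X. (g X)\<^sup>2 \<partial>P \<mu>) \<le> v"
  shows "integrable (P \<mu>) (\<lambda>X. (f X j - \<mu> j) * g X)" "\<bar>\<integral>X. (f X j - \<mu> j) * g X \<partial>P \<mu>\<bar> \<le> rmse * sqrt v"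
proof -
  have m: "(\<lambda>X. f X j - \<mu> j) \<in> borel_measurable (P \<mu>)" "g \<in> borel_measurable (P \<mu>)"
    using j by (simp_all add: measurable_sample_iff)
  show "integrable (P \<mu>) (\<lambda>X. (f X j - \<mu> j) * g X)"
    by (intro Cauchy_Schwarz_integral m g2 mse j)
  have "\<bar>\<integral>X. (f X j - \<mu> j) * g X \<partial>P \<mu>\<bar> \<le> sqrt (\<integral>X. (f X j - \<mu> j)\<^sup>2 \<partial>P \<mu>) * sqrt (\<integral>X. (g X)\<^sup>2 \<partial>P \<mu>)"
    by (intro Cauchy_Schwarz_integral m g2 mse j)
  also have "\<dots> \<le> rmse * sqrt v"
    using real_sqrt_le_mono[OF mse(2)[OF j, of \<mu>]] rmse_nonneg v by (intro mult_mono real_sqrt_le_mono) auto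
  finally show "\<bar>\<integral>X. (f X j - \<mu> j) * g X \<partial>P \<mu>\<bar> \<le> rmse * sqrt v" .
qed

text \<open>The bias is the correlation of the error with the constant 1.\<close>

lemma m_close:
  assumes j: "j < d" shows "\<bar>m j \<mu> - \<mu> j\<bar> \<le> rmse"
proof -
  interpret prob_space "P \<mu>" by (rule prob_space_sample)
  have "(\<integral>X. (f X j - \<mu> j) * 1 \<partial>P \<mu>) = m j \<mu> - \<mu> j"
    using f_integrable[OF j] prob_space by (simp add: m_def)
  thus ?thesis using covariance_bound(2)[OF j, of "\<lambda>_. 1" \<mu> 1] prob_space by simp
qed

text \<open>All reflected entries lie in rows of \<open>K\<close>, so the reflected dataset is
  admissible in the supremum.\<close>

lemma dist_le_emp_sens:
  assumes X: "X \<in> data_space d n" and K: "card K \<le> k" "finite K" and T: "T \<subseteq> K \<times> UNIV"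
  shows "ennreal (dist_d d (f X) (f (reflect d n T c X))) \<le> emp_sens d n f \<eta> X"
proof -
  \<comment> \<open>Whole rows are compared, including indices \<open>j \<ge> d\<close>: there
    membership of \<open>X\<close> in \<open>data_space\<close> makes both sides
    \<open>undefined\<close>.\<close>
  have "reflect d n T c X i = X i" if "i < n" "i \<notin> K" for i
  proof
    fix j
    have "(i, j) \<notin> T" using that T by auto
    thus "reflect d n T c X i j = X i j"
      using X that by (cases "j < d") (auto simp: reflect_def data_space_def PiE_iff extensional_def)
  qed
  hence "hamming n X (reflect d n T c X) \<le> card K"
    unfolding hamming_def by (intro card_mono K) force
  thus ?thesis unfolding emp_sens_def
    using K(1) k_eq reflect_in_data_space by (intro SUP_upper) auto
qed

text \<open>A measurable minorant of \<open>emp_sens\<close> inherits its second-moment bound, so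
  measurability of the supremum is never at issue.\<close>

lemma stability_bound:
  assumes [measurable]: "H \<in> borel_measurable D" and H0: "\<And>X. 0 \<le> H X"
    and le: "\<And>X. X \<in> data_space d n \<Longrightarrow> ennreal (H X) \<le> emp_sens d n f \<eta> X"
  shows "integrable (P \<mu>) (\<lambda>X. (H X)\<^sup>2)" "(\<integral>X. (H X)\<^sup>2 \<partial>P \<mu>) \<le> \<sigma>\<^sup>2"
proof -
  have [measurable]: "H \<in> borel_measurable (P \<mu>)" by (simp add: measurable_sample_iff)
  have "(\<integral>\<^sup>+X. ennreal ((H X)\<^sup>2) \<partial>P \<mu>) \<le> (\<integral>\<^sup>+ X. (emp_sens d n f \<eta> X)\<^sup>2 \<partial>P \<mu>)"
    using H0 le by (intro nn_integral_mono) (auto simp: space_sample ennreal_power[symmetric] intro!: power_mono)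
  also have "\<dots> \<le> ennreal (\<sigma>\<^sup>2)" by (rule f_stab)
  finally have *: "(\<integral>\<^sup>+X. ennreal ((H X)\<^sup>2) \<partial>P \<mu>) \<le> ennreal (\<sigma>\<^sup>2)" .
  thus int: "integrable (P \<mu>) (\<lambda>X. (H X)\<^sup>2)"
    by (intro integrableI_bounded) (auto intro: le_less_trans)
  show "(\<integral>X. (H X)\<^sup>2 \<partial>P \<mu>) \<le> \<sigma>\<^sup>2"
    using * int by (simp add: nn_integral_eq_integral)
qed

text \<open>The correlation with the score is the derivative of the mean of \<open>f\<close> in
  \<open>\<mu> j\<close>. A finite difference of step \<open>t\<close> replaces it: the grid
  argument gives a total of \<open>3 / 4 * d * t\<close>, of which the linearization error takes at
  most \<open>t / 4\<close> per coordinate.\<close>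

lemma exists_large_score_correlation:
  "\<exists>\<mu>. real d / 2 \<le> (\<Sum>j<d. \<integral>X. (f X j - \<mu> j) * score \<mu> {..<n} j X \<partial>P \<mu>)"
proof -
  \<comment> \<open>This step size gives \<open>n * t \<le> 1\<close> and
    \<open>rmse * (n * t) \<le> 1 / 4\<close>; the latter bounds the linearization error relative to
    \<open>t\<close>.\<close>
  define t where "t = 1 / (n * (4 * rmse + 1))"
  have n0: "real n \<ge> 1" using n_ge_1 by simp
  have pos: "n * (4 * rmse + 1) \<ge> 1" using n0 rmse_nonneg mult_mono[of 1 "real n" 1 "4 * rmse + 1"] by simp
  hence t0: "0 < t" and t1: "t \<le> 1" by (auto simp: t_def)
  have nt_eq: "n * t = 1 / (4 * rmse + 1)" using n0 by (simp add: t_def)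
  have nt: "n * t \<le> 1" unfolding nt_eq using rmse_nonneg by simp
  have nt2: "n * t\<^sup>2 \<le> 1"
    using mult_mono[OF nt t1] t0 by (simp add: power2_eq_square mult.assoc)
  have bt: "rmse * (n * t) \<le> 1 / 4" unfolding nt_eq using rmse_nonneg by (simp add: field_simps)
  obtain \<mu> where \<mu>: "3 / 4 * d * t \<le> (\<Sum>j<d. m j (\<mu>(j := \<mu> j + t)) - m j \<mu>)"
    using exists_large_divergence[of t d m rmse, OF t0 m_close] by blast
  have "m j (\<mu>(j := \<mu> j + t)) - m j \<mu> - t / 4 \<le> t * (\<integral>X. (f X j - \<mu> j) * score \<mu> {..<n} j X \<partial>P \<mu>)"
    if j: "j < d" for j
  proof -
    let ?W = "score \<mu> {..<n} j" and ?g = "\<lambda>X. f X j - \<mu> j"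
    let ?L = "\<lambda>X. exp (t * ?W X - n * t\<^sup>2 / 2)"
    interpret prob_space "P \<nu>" for \<nu> by (rule prob_space_sample)
    have [measurable]: "?W \<in> borel_measurable D" "(\<lambda>X. f X j) \<in> borel_measurable D"
      using j by (auto intro: measurable_score)
    note E = covariance_bound[OF j _ likelihood_linearization[OF j nt2, of \<mu>]]
    have g: "integrable (P \<mu>') ?g" "(\<integral>X. ?g X \<partial>P \<mu>') = m j \<mu>' - \<mu> j" for \<mu>'
      using f_integrable[OF j] prob_space[of \<mu>'] by (simp_all add: m_def)
    have L: "integrable (P \<mu>) (\<lambda>X. ?L X * ?g X)" "(\<integral>X. ?L X * ?g X \<partial>P \<mu>) = m j (\<mu>(j := \<mu> j + t)) - \<mu> j"
      using integral_shift[OF j, of ?g n \<mu> t] g[of "\<mu>(j := \<mu> j + t)"] by simp_all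
    have W': "integrable (P \<mu>) (\<lambda>X. ?g X * ?W X)" using j
      by (intro covariance_bound(1)[OF j _ _ order_refl] score_moments) auto
    have "(\<integral>X. ?g X * (?L X - 1 - t * ?W X) \<partial>P \<mu>) = (\<integral>X. ?L X * ?g X - ?g X - t * (?g X * ?W X) \<partial>P \<mu>)"
      by (intro Bochner_Integration.integral_cong refl) (simp add: algebra_simps)
    also have "\<dots> = m j (\<mu>(j := \<mu> j + t)) - m j \<mu> - t * (\<integral>X. ?g X * ?W X \<partial>P \<mu>)"
      using L g[of \<mu>] W' by simp
    finally have "\<bar>m j (\<mu>(j := \<mu> j + t)) - m j \<mu> - t * (\<integral>X. ?g X * ?W X \<partial>P \<mu>)\<bar> \<le> rmse * sqrt ((n * t\<^sup>2)\<^sup>2)"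
      using E(2) by simp
    also have "\<dots> = t * (rmse * (n * t))" by (simp add: power2_eq_square)
    also have "\<dots> \<le> t * (1 / 4)" using bt t0 by (intro mult_left_mono) auto
    finally show ?thesis by linarith
  qed
  hence "(\<Sum>j<d. m j (\<mu>(j := \<mu> j + t)) - m j \<mu> - t / 4) \<le> (\<Sum>j<d. t * (\<integral>X. (f X j - \<mu> j) * score \<mu> {..<n} j X \<partial>P \<mu>))"
    by (intro sum_mono) auto
  moreover have "(\<Sum>j<d. m j (\<mu>(j := \<mu> j + t)) - m j \<mu> - t / 4) = (\<Sum>j<d. m j (\<mu>(j := \<mu> j + t)) - m j \<mu>) - d * (t / 4)"
    by (subst sum_subtractf) simp
  ultimately have le: "3 / 4 * d * t - d * (t / 4) \<le> t * (\<Sum>j<d. \<integral>X. (f X j - \<mu> j) * score \<mu> {..<n} j X \<partial>P \<mu>)"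
    unfolding sum_distrib_left using \<mu> by linarith
  have "t * (d / 2) \<le> t * (\<Sum>j<d. \<integral>X. (f X j - \<mu> j) * score \<mu> {..<n} j X \<partial>P \<mu>)"
  proof -
    have "3 / 4 * d * t - d * (t / 4) = t * (d / 2)" by simp
    thus ?thesis using le by simp
  qed
  thus ?thesis using t0 by auto
qed

text \<open>With \<open>R\<close> the reflection of the rows in \<open>K\<close>, averaging the
  integral and its reflected form replaces the error of \<open>f\<close> by half of
  \<open>f X - f (R X)\<close>. This difference is bounded by the sensitivity, and the squared norm
  of the block score has mean \<open>card K * d\<close>.\<close>

lemma block_correlation_le:
  assumes K: "K \<subseteq> {..<n}" "card K \<le> k"
  shows "(\<Sum>j<d. \<integral>X. (f X j - \<mu> j) * score \<mu> K j X \<partial>P \<mu>) \<le> \<sigma> * sqrt (k * d) / 2"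
proof -
  let ?R = "reflect d n (K \<times> {..<d}) \<mu>" and ?W = "\<lambda>j. score \<mu> K j"
  let ?g = "\<lambda>j X. f X j - \<mu> j"
  let ?H = "\<lambda>X. dist_d d (f X) (f (?R X))" and ?V = "\<lambda>X. sqrt (\<Sum>j<d. (?W j X)\<^sup>2)"
  have fin: "finite K" using K finite_subset by blast
  have [measurable]: "?W j \<in> borel_measurable D" if "j < d" for j
    using that K by (intro measurable_score) auto
  have Vm[measurable]: "?V \<in> borel_measurable D" by measurable
  have Wint: "integrable (P \<mu>) (\<lambda>X. ?g j X * ?W j X)" if "j < d" for j
    by (rule covariance_bound(1)[OF that _ _ order_refl]) (use that K score_moments in auto)
  have WR: "?W j (?R X) = - ?W j X" if "j < d" for j X
    using that K by (auto simp: score_def reflect_apply subset_eq sum_negf[symmetric] intro!: sum.cong)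
  have reflW: "(\<integral>X. ?g j X * ?W j X \<partial>P \<mu>) = (\<integral>X. ?g j (?R X) * - ?W j X \<partial>P \<mu>)"
    "integrable (P \<mu>) (\<lambda>X. ?g j (?R X) * - ?W j X)" if "j < d" for j
    using integral_reflect[of "?g j" d n "?W j" "\<lambda>X. - ?W j X" \<mu> "K \<times> {..<d}" \<mu> \<mu>] that Wint[OF that]
    by (auto simp: dens_reflect WR)
  have H: "integrable (P \<mu>) (\<lambda>X. (?H X)\<^sup>2)" "(\<integral>X. (?H X)\<^sup>2 \<partial>P \<mu>) \<le> \<sigma>\<^sup>2"
    by (intro stability_bound measurable_dist measurable_reflect dist_le_emp_sens[OF _ K(2) fin];
        auto simp: dist_d_def sum_nonneg)+
  have V: "integrable (P \<mu>) (\<lambda>X. (?V X)\<^sup>2)" "(\<integral>X. (?V X)\<^sup>2 \<partial>P \<mu>) = card K * d"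
    using score_moments(3,4)[OF K(1), of _ d \<mu>]
    by (auto simp: sum_nonneg intro!: Bochner_Integration.integrable_sum)
  have "2 * (\<Sum>j<d. \<integral>X. ?g j X * ?W j X \<partial>P \<mu>)
      = (\<Sum>j<d. (\<integral>X. ?g j X * ?W j X \<partial>P \<mu>) + (\<integral>X. ?g j (?R X) * - ?W j X \<partial>P \<mu>))"
    using reflW(1) by (simp add: sum_distrib_left)
  also have "\<dots> = (\<integral>X. (\<Sum>j<d. ?g j X * ?W j X + ?g j (?R X) * - ?W j X) \<partial>P \<mu>)"
    using Wint reflW(2) by (simp del: mult_minus_right)
  also have "\<dots> \<le> (\<integral>X. ?H X * ?V X \<partial>P \<mu>)"
  proof (rule integral_mono)
    show "integrable (P \<mu>) (\<lambda>X. \<Sum>j<d. ?g j X * ?W j X + ?g j (?R X) * - ?W j X)"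
      using Wint reflW(2)
      by (intro Bochner_Integration.integrable_sum Bochner_Integration.integrable_add) auto
    show "integrable (P \<mu>) (\<lambda>X. ?H X * ?V X)"
      by (intro Cauchy_Schwarz_integral H V) (simp_all add: measurable_sample_iff measurable_dist)
    fix X
    have "(\<Sum>j<d. ?g j X * ?W j X + ?g j (?R X) * - ?W j X) = (\<Sum>j<d. (f X j - f (?R X) j) * ?W j X)"
    proof (intro sum.cong refl)
      fix j
      have "(a - c) * w + (b - c) * - w = (a - b) * w" for a b c w :: real
        by (simp add: algebra_simps)
      thus "?g j X * ?W j X + ?g j (?R X) * - ?W j X = (f X j - f (?R X) j) * ?W j X" .
    qed
    also have "\<dots> \<le> (\<Sum>j<d. \<bar>f X j - f (?R X) j\<bar> * \<bar>?W j X\<bar>)"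
      by (intro sum_mono) (simp add: abs_mult[symmetric])
    also have "\<dots> \<le> ?H X * ?V X"
      using L2_set_mult_ineq[of "\<lambda>j. f X j - f (?R X) j" "\<lambda>j. ?W j X" "{..<d}"]
      by (simp add: L2_set_def dist_d_def)
    finally show "(\<Sum>j<d. ?g j X * ?W j X + ?g j (?R X) * - ?W j X) \<le> ?H X * ?V X" .
  qed
  also have "\<dots> \<le> sqrt (\<integral>X. (?H X)\<^sup>2 \<partial>P \<mu>) * sqrt (\<integral>X. (?V X)\<^sup>2 \<partial>P \<mu>)"
    by (rule order_trans[OF abs_ge_self], intro Cauchy_Schwarz_integral H V)
       (simp_all add: measurable_sample_iff measurable_dist)
  also have "\<dots> \<le> \<sigma> * sqrt (k * d)"
    unfolding V(2) using H \<sigma> K(2) by (intro mult_mono real_le_lsqrt real_sqrt_le_mono) (auto intro: mult_right_mono)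
  finally show ?thesis by simp
qed

text \<open>The full score is the sum of the scores of about \<open>n / k\<close> blocks, each
  bounded by \<open>block_correlation_le\<close>.\<close>

lemma dimension_bound: "sqrt (k * d) / (2 * n) \<le> \<sigma>"
proof -
  obtain \<mu> where \<mu>: "real d / 2 \<le> (\<Sum>j<d. \<integral>X. (f X j - \<mu> j) * score \<mu> {..<n} j X \<partial>P \<mu>)"
    using exists_large_score_correlation by blast
  \<comment> \<open>Blocks of consecutive indices; the last of the \<open>N\<close> blocks may be
    short or empty.\<close>
  define K where "K b = {i\<in>{..<n}. i div k = b}" for b
  define N where "N = Suc (n div k)"
  have k0: "k > 0" using k by simp
  have K: "K b \<subseteq> {..<n}" "card (K b) \<le> k" for b
  proof -
    show "K b \<subseteq> {..<n}" by (auto simp: K_def)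
    have "K b \<subseteq> {b * k..<b * k + k}"
      using dividend_less_div_times[OF k0] by (auto simp: K_def add.commute)
    thus "card (K b) \<le> k" using card_mono[of "{b * k..<b * k + k}" "K b"] by simp
  qed
  have score: "score \<mu> {..<n} j X = (\<Sum>b<N. score \<mu> (K b) j X)" for j X
  proof -
    have "(\<Sum>b<N. \<Sum>i\<in>{i\<in>{..<n}. i div k = b}. X i j - \<mu> j) = (\<Sum>i\<in>{..<n}. X i j - \<mu> j)"
      by (intro sum.group) (auto simp: N_def less_Suc_eq_le div_le_mono)
    thus ?thesis by (simp add: score_def K_def)
  qed
  have int: "integrable (P \<mu>) (\<lambda>X. (f X j - \<mu> j) * score \<mu> (K b) j X)" if "j < d" for j b
    by (rule covariance_bound(1)[OF that _ _ order_refl])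
       (use that K score_moments measurable_score in auto)
  have "real d / 2 \<le> (\<Sum>j<d. \<Sum>b<N. \<integral>X. (f X j - \<mu> j) * score \<mu> (K b) j X \<partial>P \<mu>)"
    using \<mu> int by (simp add: score sum_distrib_left)
  also have "\<dots> = (\<Sum>b<N. \<Sum>j<d. \<integral>X. (f X j - \<mu> j) * score \<mu> (K b) j X \<partial>P \<mu>)"
    by (rule sum.swap)
  also have "\<dots> \<le> (\<Sum>b<N. \<sigma> * sqrt (k * d) / 2)"
    using K by (intro sum_mono block_correlation_le)
  finally have 1: "real d \<le> N * (\<sigma> * sqrt (k * d))" by simp
  \<comment> \<open>Here \<open>k \<le> n\<close> absorbs the additional block into the factor
    2.\<close>
  have "real N * k \<le> 2 * n"
  proof -
    have "n div k * k \<le> n" by (rule div_times_less_eq_dividend)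
    moreover have "N * k = k + n div k * k" by (simp add: N_def)
    ultimately have "N * k \<le> 2 * n" using k by linarith
    thus ?thesis by (metis of_nat_le_iff of_nat_mult of_nat_numeral)
  qed
  hence "(N * k) * (\<sigma> * sqrt (k * d)) \<le> (2 * n) * (\<sigma> * sqrt (k * d))"
    using \<sigma> by (intro mult_right_mono) auto
  hence "sqrt (k * d) * sqrt (k * d) \<le> (2 * n * \<sigma>) * sqrt (k * d)"
    using mult_right_mono[OF 1, of k] by (simp add: algebra_simps)
  hence "sqrt (k * d) \<le> 2 * n * \<sigma>" by (rule mult_right_le_imp_le) (use k0 d in simp)
  thus ?thesis using n_ge_1 by (simp add: field_simps)
qed

end

section \<open>The truncated reflection coupling\<close>

text \<open>\<open>k ^ k / fact k\<close> is one term of the series for \<open>exp k\<close>, and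
  \<open>exp 1 \<le> 3\<close>.\<close>

lemma power_self_le_fact: "real k ^ k \<le> 3 ^ k * fact k"
proof -
  have "(\<Sum>i\<in>{k}. real k ^ i /\<^sub>R fact i) \<le> (\<Sum>i. real k ^ i /\<^sub>R fact i)"
    using summable_exp_generic[of "real k"] by (intro sum_le_suminf) auto
  hence "real k ^ k / fact k \<le> exp (real k)"
    by (simp add: exp_def divide_inverse mult.commute)
  also have "exp (real k) = exp 1 ^ k" by (simp add: exp_of_nat_mult[symmetric])
  also have "\<dots> \<le> 3 ^ k" by (intro power_mono exp_le) auto
  finally show ?thesis by (simp add: field_simps)
qed

text \<open>The quotient is at most \<open>(6 * \<gamma>) ^ k\<close>. One factor is kept, and the
  other \<open>k - 1\<close> factors, each at most 1/2, give \<open>1 / k\<close>. That gain later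
  compensates the dimension in the mean squared error when \<open>d \<le> k\<close>.\<close>

lemma poisson_tail_le:
  fixes x \<gamma> :: real
  assumes k: "1 \<le> k" and \<gamma>: "0 \<le> \<gamma>" "\<gamma> \<le> 1 / 12" and x: "0 \<le> x" "x \<le> 2 * \<gamma> * k"
  shows "x ^ k / fact k \<le> 6 * \<gamma> / k"
proof -
  obtain k' where k': "k = Suc k'" using k by (cases k) auto
  have "x ^ k \<le> (2 * \<gamma> * k) ^ k" using x(2,1) by (rule power_mono)
  also have "\<dots> = (2 * \<gamma>) ^ k * real k ^ k" by (rule power_mult_distrib)
  also have "\<dots> \<le> (2 * \<gamma>) ^ k * (3 ^ k * fact k)"
    using \<gamma> by (intro mult_left_mono power_self_le_fact) auto
  also have "\<dots> = (6 * \<gamma>) ^ k * fact k"   proof -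
    have "(6 * \<gamma>) ^ k = (2 * \<gamma>) ^ k * 3 ^ k" by (subst power_mult_distrib[symmetric]) simp
    thus ?thesis by (simp only: mult.assoc)
  qed
  finally have "x ^ k / fact k \<le> (6 * \<gamma>) ^ k" by (simp add: field_simps)
  also have "\<dots> = 6 * \<gamma> * (6 * \<gamma>) ^ k'" by (simp add: k')
  also have "\<dots> \<le> 6 * \<gamma> * (1 / 2) ^ k'"
    using \<gamma> by (intro mult_left_mono power_mono) auto
  also have "\<dots> \<le> 6 * \<gamma> * (1 / k)"
  proof -
    have "k \<le> 2 ^ k'" unfolding k' by (induction k') auto
    hence "real k \<le> 2 ^ k'" by (metis of_nat_le_iff of_nat_numeral of_nat_power)
    hence "(1 / 2) ^ k' \<le> 1 / real k" using k by (simp add: power_one_over field_simps)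
    thus ?thesis using \<gamma> by (intro mult_left_mono) auto
  qed
  finally show ?thesis by simp
qed

text \<open>\<open>exceed k\<close> applied through \<open>bern_mean\<close> is the conditional probability of more than \<open>k\<close> flips.\<close>

definition exceed :: "nat \<Rightarrow> nat \<Rightarrow> real" where
  "exceed k m = (if k < m then 1 else 0)"

text \<open>The mean number of flips is at most \<open>2 * \<gamma> * k\<close>, so Markov's
  inequality bounds the chance of exceeding \<open>k\<close>. For the variance, Efron--Stein leaves
  only the probability of exactly \<open>k\<close> flips among \<open>n - 1\<close> points, which is
  small by \<open>poisson_tail_le\<close>.\<close>

lemma flip_count_moments:
  fixes p :: "(nat \<Rightarrow> real) \<Rightarrow> real" and \<gamma> \<delta> :: real
  assumes p_meas: "p \<in> borel_measurable (gauss d \<nu>)" and p01: "\<And>x. 0 \<le> p x" "\<And>x. p x \<le> 1"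
    and p_le: "\<forall>x. p x \<le> \<delta> * \<bar>x j - c\<bar>" and j: "j < d" and c: "\<bar>\<nu> j - c\<bar> \<le> 1"
    and \<gamma>: "0 < \<gamma>" "\<gamma> \<le> 1 / 12" and k: "1 \<le> k" "k \<le> n" and \<delta>: "\<delta> = \<gamma> * k / n"
  defines "a \<equiv> \<lambda>X. bern_mean n (\<lambda>i. p (X i)) (exceed k)"
  shows "a \<in> borel_measurable (data_borel d n)" "(\<integral>X. a X \<partial>sample d n \<nu>) \<le> 2 * \<gamma>"
    "(\<integral>X. (a X - (\<integral>X. a X \<partial>sample d n \<nu>))\<^sup>2 \<partial>sample d n \<nu>) \<le> 12 * \<gamma> * n * \<delta>\<^sup>2 / k"
proof -
  interpret prob_space "gauss d \<nu>" by (rule prob_space_gauss)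
  interpret bernoulli_mixture "gauss d \<nu>" p by unfold_locales (use p_meas p01 in auto)
  have S: "sample d N \<nu> = S N" for N by (simp add: sample_def)
  show "a \<in> borel_measurable (data_borel d n)"
    unfolding a_def measurable_sample_iff[where \<mu> = \<nu>, symmetric] S by (rule B_meas) simp
  define q where "q = (\<integral>x. (p x)\<^sup>2 \<partial>gauss d \<nu>)"
  obtain n' where n': "n = Suc n'" using k by (cases n) auto
  have n0: "real n > 0" by (simp add: n')
  have \<delta>0: "0 < \<delta>" using \<gamma> k n0 by (simp add: \<delta>)
  have p2: "integrable (gauss d \<nu>) (\<lambda>x. (p x)\<^sup>2)"
    using p01 by (intro integrable_const_bound[of _ 1]) (auto simp: power_le_one)
  have "q \<le> (\<integral>x. \<delta>\<^sup>2 * (x j - c)\<^sup>2 \<partial>gauss d \<nu>)"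
    unfolding q_def
  proof (rule integral_mono[OF p2])
    show "integrable (gauss d \<nu>) (\<lambda>x. \<delta>\<^sup>2 * (x j - c)\<^sup>2)"
      using gauss_moments(3)[OF j] by (rule integrable_mult_right)
    show "(p x)\<^sup>2 \<le> \<delta>\<^sup>2 * (x j - c)\<^sup>2" for x
      using power_mono[OF p_le[rule_format] p01(1), of x 2] by (simp add: power_mult_distrib)
  qed
  also have "\<dots> = \<delta>\<^sup>2 * (1 + (\<nu> j - c)\<^sup>2)" using gauss_moments(4)[OF j] by simp
  also have "\<dots> \<le> \<delta>\<^sup>2 * 2"
    using c by (intro mult_left_mono) (auto simp: abs_square_le_1)
  finally have q: "q \<le> 2 * \<delta>\<^sup>2" by simp
  have q0: "0 \<le> q" unfolding q_def by simp
  have "mp\<^sup>2 \<le> q"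
  proof -
    have "0 \<le> (\<integral>x. (p x - mp)\<^sup>2 \<partial>gauss d \<nu>)" by simp
    also have "\<dots> = q - mp\<^sup>2"
      unfolding q_def using p01 by (intro variance_eq p2 integrable_const_bound[of _ 1]) auto
    finally show ?thesis by simp
  qed
  moreover have "2 * \<delta>\<^sup>2 \<le> (2 * \<delta>)\<^sup>2" by (simp add: power_mult_distrib)
  ultimately have "mp\<^sup>2 \<le> (2 * \<delta>)\<^sup>2" using q by linarith
  hence mp: "mp \<le> 2 * \<delta>" by (rule power2_le_imp_le) (use \<delta>0 in simp)
  have nmp: "n * mp \<le> 2 * \<gamma> * k"
    using mult_left_mono[OF mp, of "real n"] n0 by (simp add: \<delta>)
  have a_int: "(\<integral>X. a X \<partial>sample d n \<nu>) = bern_mean n (\<lambda>_. mp) (exceed k)"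
    unfolding S a_def by (rule B_integral)
  \<comment> \<open>Markov's inequality in pointwise form,
    \<open>exceed k m \<le> m / k\<close>.\<close>
  also have "\<dots> \<le> bern_mean n (\<lambda>_. mp) (\<lambda>m. real m / k)"
    using mp01 k by (intro bern_mean_mono) (auto simp: exceed_def)
  also have "\<dots> = bern_mean n (\<lambda>_. mp) real / k"
    by (simp add: bern_mean_def sum_divide_distrib)
  also have "\<dots> \<le> 2 * \<gamma>"
    using nmp k by (simp add: bern_mean_id divide_le_eq)
  finally show "(\<integral>X. a X \<partial>sample d n \<nu>) \<le> 2 * \<gamma>" .
  \<comment> \<open>\<open>exceed k\<close> increases only from \<open>k\<close> to
    \<open>k + 1\<close>, so its squared increment is the indicator of a single point.\<close>
  have jump: "(exceed k (Suc m) - exceed k m)\<^sup>2 = (if m = k then 1 else 0)" for m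
    by (auto simp: exceed_def)
  have nmp': "n' * mp \<le> 2 * \<gamma> * k" "0 \<le> n' * mp"
    using nmp mp01 by (auto simp: n' algebra_simps)
  have pt: "bern_mean n' (\<lambda>_. mp) (\<lambda>m. if m = k then 1 else 0) \<le> 6 * \<gamma> / k"
    using \<gamma>(1) by (intro order_trans[OF bern_mean_point_le[OF mp01] poisson_tail_le[OF k(1) _ \<gamma>(2) nmp'(2,1)]]) simp
  have "(\<integral>X. (a X - (\<integral>X. a X \<partial>sample d n \<nu>))\<^sup>2 \<partial>sample d n \<nu>)
      \<le> n * q * bern_mean n' (\<lambda>_. mp) (\<lambda>m. if m = k then 1 else 0)"
    using B_variance[of n' "exceed k"] unfolding a_int unfolding jump q_def S a_def n' .
  also have "\<dots> \<le> n * (2 * \<delta>\<^sup>2) * (6 * \<gamma> / k)"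
    using mp01 q q0 pt by (intro mult_mono mult_nonneg_nonneg bern_mean_nonneg) auto
  also have "\<dots> = 12 * \<gamma> * n * \<delta>\<^sup>2 / k" by simp
  finally show "(\<integral>X. (a X - (\<integral>X. a X \<partial>sample d n \<nu>))\<^sup>2 \<partial>sample d n \<nu>) \<le> 12 * \<gamma> * n * \<delta>\<^sup>2 / k" .
qed

text \<open>The probability that the maximal (reflection) coupling of \<open>N(-\<delta>/2, 1)\<close> and \<open>N(\<delta>/2, 1)\<close>
  flips, given that its second component is \<open>y\<close>.\<close>

definition flip_prob :: "real \<Rightarrow> real \<Rightarrow> real" where
  "flip_prob \<delta> y = max 0 (1 - exp (- (\<delta> * y)))"

lemma flip_prob_bounds:
  "0 \<le> flip_prob \<delta> y" "flip_prob \<delta> y \<le> 1" "0 \<le> \<delta> \<Longrightarrow> flip_prob \<delta> y \<le> \<delta> * \<bar>y\<bar>"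
proof -
  show "0 \<le> flip_prob \<delta> y" "flip_prob \<delta> y \<le> 1" by (auto simp: flip_prob_def)
  assume "0 \<le> \<delta>"
  hence "\<delta> * y \<le> \<delta> * \<bar>y\<bar>" "0 \<le> \<delta> * \<bar>y\<bar>" by (auto intro: mult_left_mono)
  moreover have "1 - exp (- (\<delta> * y)) \<le> \<delta> * y" using exp_ge_add_one_self[of "- (\<delta> * y)"] by simp
  ultimately show "flip_prob \<delta> y \<le> \<delta> * \<bar>y\<bar>" by (simp add: flip_prob_def)
qed

lemma flip_prob_measurable[measurable]: "flip_prob \<delta> \<in> borel_measurable borel"
  unfolding flip_prob_def[abs_def] by measurable

text \<open>Both sides equal \<open>min 1 (exp (\<delta> * y))\<close>, where
  \<open>exp (\<delta> * y)\<close> is the density ratio at \<open>y\<close>: the unflipped mass is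
  the overlap of the two densities, seen from either marginal.\<close>

lemma no_flip_balance:
  assumes "0 < \<delta>"
  shows "exp (\<delta> * y) * (1 - flip_prob \<delta> y) = 1 - flip_prob \<delta> (- y)"
proof (cases "0 \<le> y")
  case True
  hence "0 \<le> \<delta> * y" using assms by simp
  moreover from this have "exp (- (\<delta> * y)) \<le> 1" by simp
  ultimately show ?thesis by (simp add: flip_prob_def exp_add[symmetric])
next
  case False
  hence "\<delta> * y \<le> 0" using assms by (simp add: mult_le_0_iff)
  thus ?thesis by (simp add: flip_prob_def max_def)
qed

lemma bern_measurable:
  assumes j: "j < d" and [measurable]: "p \<in> borel_measurable (borel :: real measure)"
  shows "(\<lambda>X. bern n (\<lambda>i. p (X i j)) T) \<in> borel_measurable (data_borel d n)"
proof -
  have "(\<lambda>X. p (X i j)) \<in> borel_measurable (data_borel d n)" if "i < n" for i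
    using that j by measurable
  thus ?thesis unfolding bern_def[abs_def] by (intro borel_measurable_prod) auto
qed

lemma bern_le_1: "(\<And>i. i < n \<Longrightarrow> 0 \<le> q i \<and> q i \<le> 1) \<Longrightarrow> bern n q T \<le> 1"
  unfolding bern_def by (intro prod_le_1) auto

text \<open>The coupling split by its flip set \<open>T\<close>, without a joint space: reflecting
  at the midpoint \<open>c\<close> matches the two laws, each weighted by the conditional
  probability of \<open>T\<close>. In a flipped row the reflection exchanges the densities; an
  unflipped row is \<open>no_flip_balance\<close>.\<close>

lemma coupling_density:
  assumes j: "j < d" and \<delta>: "0 < \<delta>" and c: "c = \<mu>(j := \<mu> j + \<delta> / 2)"
  shows "dens d n (\<mu>(j := \<mu> j + \<delta>)) (reflect d n (T \<times> {j}) c X)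
      * bern n (\<lambda>i. flip_prob \<delta> (reflect d n (T \<times> {j}) c X i j - c j)) T
    = dens d n \<mu> X * bern n (\<lambda>i. flip_prob \<delta> (c j - X i j)) T"
  unfolding dens_def bern_def prod.distrib[symmetric]
proof (intro prod.cong refl)
  fix i assume "i \<in> {..<n}"
  hence i: "i < n" by simp
  let ?R = "reflect d n (T \<times> {j}) c" and ?\<mu> = "\<mu>(j := \<mu> j + \<delta>)"
  have rest: "(\<Prod>j'\<in>{..<d}-{j}. normal_density (?\<mu> j') 1 (?R X i j')) = (\<Prod>j'\<in>{..<d}-{j}. normal_density (\<mu> j') 1 (X i j'))"
    using i by (intro prod.cong) (auto simp: reflect_apply)
  have ent: "normal_density (\<mu> j + \<delta>) 1 (?R X i j) * (if i \<in> T then flip_prob \<delta> (?R X i j - c j) else 1 - flip_prob \<delta> (?R X i j - c j))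
      = normal_density (\<mu> j) 1 (X i j) * (if i \<in> T then flip_prob \<delta> (c j - X i j) else 1 - flip_prob \<delta> (c j - X i j))"
  proof (cases "i \<in> T")
    case True
    have "normal_density (\<mu> j + \<delta>) 1 (2 * c j - X i j) = normal_density (\<mu> j) 1 (X i j)"
      unfolding normal_density_reflect by (simp add: c)
    moreover have "2 * c j - X i j - c j = c j - X i j" by simp
    ultimately show ?thesis using True i j by (simp add: reflect_apply)
  next
    case False
    \<comment> \<open>The log-likelihood ratio is \<open>\<delta>\<close> times the offset from the
      midpoint.\<close>
    have "\<delta> * (X i j - \<mu> j) - \<delta>\<^sup>2 / 2 = \<delta> * (X i j - c j)"
      by (simp add: c power2_eq_square algebra_simps)
    thus ?thesis using False i j no_flip_balance[OF \<delta>, of "X i j - c j"]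
      by (simp add: reflect_apply normal_density_shift)
  qed
  have split: "(\<Prod>j'<d. g j') = g j * (\<Prod>j'\<in>{..<d}-{j}. g j')" for g :: "nat \<Rightarrow> real"
    using j by (intro prod.remove) auto
  show "(\<Prod>j'<d. normal_density (?\<mu> j') 1 (?R X i j')) * (if i \<in> T then flip_prob \<delta> (?R X i j - c j) else 1 - flip_prob \<delta> (?R X i j - c j))
      = (\<Prod>j'<d. normal_density (\<mu> j') 1 (X i j')) * (if i \<in> T then flip_prob \<delta> (c j - X i j) else 1 - flip_prob \<delta> (c j - X i j))"
    unfolding split[of "\<lambda>j'. normal_density (?\<mu> j') 1 (?R X i j')"] split[of "\<lambda>j'. normal_density (\<mu> j') 1 (X i j')"] rest
    using ent by (simp add: mult.commute mult.left_commute)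
qed

section \<open>Increments of the mean under the coupling, for \<open>d \<le> k\<close>\<close>

context stable_estimator
begin

text \<open>Both means are sums over the flip set \<open>T\<close>. For
  \<open>card T \<le> k\<close> the coupled samples differ in at most \<open>k\<close> rows, and the
  difference of these terms totals at most \<open>\<sigma>\<close>; the terms with more flips are
  close to \<open>\<beta>\<close> times the respective mean, whence the factor
  \<open>1 - \<beta>\<close>.\<close>

lemma increment_bound:
  fixes \<mu> :: "nat \<Rightarrow> real" and \<gamma> :: real
  assumes j: "j < d" and \<gamma>: "0 < \<gamma>" "\<gamma> \<le> 1 / 12" and \<delta>: "\<delta> = \<gamma> * k / n" and kd: "d \<le> k"
  obtains \<beta> where "\<beta> \<le> 2 * \<gamma>"
    "(1 - \<beta>) * (m j (\<mu>(j := \<mu> j + \<delta>)) - m j \<mu>) \<le> \<sigma> + 2 * \<delta> * sqrt (12 * \<gamma> * C)"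
proof -
  define c where "c = \<mu>(j := \<mu> j + \<delta> / 2)"
  define \<nu> where "\<nu> = \<mu>(j := \<mu> j + \<delta>)"
  define R where "R T = reflect d n (T \<times> {j}) c" for T
  \<comment> \<open>\<open>wp T\<close> and \<open>wm T\<close> are the conditional probabilities of
    the flip set \<open>T\<close> given the second sample (mean \<open>\<nu>\<close>) and the first
    (mean \<open>\<mu>\<close>).\<close>
  define wp where "wp T X = bern n (\<lambda>i. flip_prob \<delta> (X i j - c j)) T" for T and X :: "nat \<Rightarrow> nat \<Rightarrow> real"
  define wm where "wm T X = bern n (\<lambda>i. flip_prob \<delta> (c j - X i j)) T" for T and X :: "nat \<Rightarrow> nat \<Rightarrow> real"
  let ?g = "\<lambda>X. f X j"
  interpret Pp: prob_space "P \<nu>" by (rule prob_space_sample)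
  interpret Pm: prob_space "P \<mu>" by (rule prob_space_sample)
  have n0: "real n > 0" using n_ge_1 by simp
  have \<delta>0: "0 < \<delta>" using \<gamma> k n0 by (simp add: \<delta>)
  have \<delta>1: "\<delta> \<le> 1"
  proof -
    have "\<gamma> * real k \<le> 1 * real n" using \<gamma> k by (intro mult_mono) auto
    thus ?thesis using n0 by (simp add: \<delta> divide_le_eq)
  qed
  have [measurable]: "?g \<in> borel_measurable D" using j by simp
  have [measurable]: "R T \<in> measurable D D" for T unfolding R_def by (rule measurable_reflect)
  have gR[measurable]: "(\<lambda>X. f (R T X) j) \<in> borel_measurable D" for T
    by (rule measurable_compose[of "R T" _ D]) (use j in auto)
  have [measurable]: "wp T \<in> borel_measurable D" "wm T \<in> borel_measurable D" for T
    unfolding wp_def[abs_def] wm_def[abs_def]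
    using bern_measurable[OF j, of "\<lambda>x. flip_prob \<delta> (x - c j)"] bern_measurable[OF j, of "\<lambda>x. flip_prob \<delta> (c j - x)"] by auto
  have w01: "0 \<le> wp T X" "wp T X \<le> 1" "0 \<le> wm T X" "wm T X \<le> 1" for T X
    unfolding wp_def wm_def by (auto intro!: bern_nonneg bern_le_1 simp: flip_prob_bounds)
  have w_sum: "(\<Sum>T\<in>Pow {..<n}. wp T X) = 1" "(\<Sum>T\<in>Pow {..<n}. wm T X) = 1" for X
    using bern_mean_const[of n _ 1] by (simp_all add: wp_def wm_def bern_mean_def)
  have mult_int: "integrable (P \<theta>) (\<lambda>X. h X * w X)"
    if "integrable (P \<theta>) h" "w \<in> borel_measurable D" "\<And>X. \<bar>w X\<bar> \<le> 1" for \<theta> and h w :: "_ \<Rightarrow> real"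
    using that by (intro Bochner_Integration.integrable_bound[OF that(1)] borel_measurable_times)
       (auto simp: measurable_sample_iff abs_mult intro!: mult_left_le)
  have gwp: "integrable (P \<nu>) (\<lambda>X. ?g X * wp T X)" for T
    using w01 by (intro mult_int f_integrable j) auto
  have gwm: "integrable (P \<mu>) (\<lambda>X. ?g X * wm T X)" for T
    using w01 by (intro mult_int f_integrable j) auto
  note cd = coupling_density[OF j \<delta>0 c_def, of n, folded \<nu>_def R_def, folded wp_def wm_def]
  have cov: "(\<integral>X. h X * wp T X \<partial>P \<nu>) = (\<integral>X. h (R T X) * wm T X \<partial>P \<mu>)"
    "integrable (P \<nu>) (\<lambda>X. h X * wp T X) = integrable (P \<mu>) (\<lambda>X. h (R T X) * wm T X)"
    if "h \<in> borel_measurable D" for T and h :: "_ \<Rightarrow> real"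
    unfolding R_def using that cd[unfolded R_def] by (intro integral_reflect; simp)+
  have gRwm: "integrable (P \<mu>) (\<lambda>X. f (R T X) j * wm T X)" for T
    using cov(2)[of ?g T] gwp by simp
  define small where "small = {T\<in>Pow {..<n}. card T \<le> k}"
  define large where "large = {T\<in>Pow {..<n}. k < card T}"
  have fin: "finite small" "finite large" and disj: "small \<inter> large = {}" and un: "Pow {..<n} = small \<union> large"
    by (auto simp: small_def large_def)
  \<comment> \<open>\<open>ap\<close> and \<open>am\<close> are the conditional probabilities of
    more than \<open>k\<close> flips given the second and the first sample.\<close>
  define ap where "ap X = (\<Sum>T\<in>large. wp T X)" for X
  define am where "am X = (\<Sum>T\<in>large. wm T X)" for X
  have ap: "ap X = bern_mean n (\<lambda>i. flip_prob \<delta> (X i j - c j)) (exceed k)"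
    and am: "am X = bern_mean n (\<lambda>i. flip_prob \<delta> (c j - X i j)) (exceed k)" for X
    unfolding ap_def am_def wp_def wm_def bern_mean_def large_def exceed_def
    by (subst sum.inter_filter; simp add: if_distrib[of "\<lambda>x. x * _"] cong: if_cong)+
  have mgauss: "(\<lambda>x. flip_prob \<delta> (x j - c j)) \<in> borel_measurable (gauss d \<nu>)"
    "(\<lambda>x. flip_prob \<delta> (c j - x j)) \<in> borel_measurable (gauss d \<mu>)"
  proof -
    have [measurable]: "(\<lambda>x. x j) \<in> borel_measurable (gauss d \<theta>)" for \<theta> by (rule measurable_gauss_entry[OF j])
    show "(\<lambda>x. flip_prob \<delta> (x j - c j)) \<in> borel_measurable (gauss d \<nu>)"
      "(\<lambda>x. flip_prob \<delta> (c j - x j)) \<in> borel_measurable (gauss d \<mu>)" by measurable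
  qed
  have fl: "\<forall>x. flip_prob \<delta> (x j - c j) \<le> \<delta> * \<bar>x j - c j\<bar>"
    "\<forall>x. flip_prob \<delta> (c j - x j) \<le> \<delta> * \<bar>x j - c j\<bar>"
  proof -
    show "\<forall>x. flip_prob \<delta> (x j - c j) \<le> \<delta> * \<bar>x j - c j\<bar>"
      using flip_prob_bounds(3) \<delta>0 by simp
    show "\<forall>x. flip_prob \<delta> (c j - x j) \<le> \<delta> * \<bar>x j - c j\<bar>"
      unfolding abs_minus_commute[of "_ j" "c j"] using flip_prob_bounds(3) \<delta>0 by simp
  qed
  have cc: "\<bar>\<nu> j - c j\<bar> \<le> 1" "\<bar>\<mu> j - c j\<bar> \<le> 1" using \<delta>0 \<delta>1 by (auto simp: \<nu>_def c_def)
  note fp = flip_count_moments[where p = "\<lambda>x. flip_prob \<delta> (x j - c j)" and j = j and c = "c j" and \<delta> = \<delta> and \<nu> = \<nu>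
      and d = d, OF mgauss(1) flip_prob_bounds(1,2) fl(1) j cc(1) \<gamma> k \<delta>, folded ap]
  note fm = flip_count_moments[where p = "\<lambda>x. flip_prob \<delta> (c j - x j)" and j = j and c = "c j" and \<delta> = \<delta> and \<nu> = \<mu>
      and d = d, OF mgauss(2) flip_prob_bounds(1,2) fl(2) j cc(2) \<gamma> k \<delta>, folded am]
  have [measurable]: "ap \<in> borel_measurable D" "am \<in> borel_measurable D"
    using fp(1) fm(1) by simp_all
  define \<beta> where "\<beta> = (\<integral>X. ap X \<partial>P \<nu>)"
  have wint: "integrable (P \<nu>) (wp T)" "integrable (P \<mu>) (wm T)" for T
    using w01 by (auto intro!: Pp.integrable_const_bound[of _ 1] Pm.integrable_const_bound[of _ 1] simp: measurable_sample_iff)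
  \<comment> \<open>The coupling identity for the constant function 1: both samples yield the same
    overall probability of more than \<open>k\<close> flips.\<close>
  have \<beta>m: "\<beta> = (\<integral>X. am X \<partial>P \<mu>)"
    unfolding \<beta>_def ap_def am_def using wint cov(1)[of "\<lambda>_. 1"] by simp
  have \<beta>: "\<beta> \<le> 2 * \<gamma>" unfolding \<beta>_def using fp(2) .
  have a01: "0 \<le> ap X" "ap X \<le> 1" "0 \<le> am X" "am X \<le> 1" for X
  proof -
    show "0 \<le> ap X" "0 \<le> am X" unfolding ap_def am_def using w01 by (auto intro: sum_nonneg)
    have "ap X \<le> (\<Sum>T\<in>Pow {..<n}. wp T X)" "am X \<le> (\<Sum>T\<in>Pow {..<n}. wm T X)"
      unfolding ap_def am_def using w01 by (intro sum_mono2; auto simp: large_def)+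
    thus "ap X \<le> 1" "am X \<le> 1" unfolding w_sum by auto
  qed
  define v where "v = 12 * \<gamma> * n * \<delta>\<^sup>2 / k"
  \<comment> \<open>Here \<open>d \<le> k\<close> enters: \<open>rmse\<^sup>2 * v\<close> equals
    \<open>12 * \<gamma> * C * \<delta>\<^sup>2 * (d / k)\<close>.\<close>
  have bv: "rmse * sqrt v \<le> \<delta> * sqrt (12 * \<gamma> * C)"
  proof -
    have "rmse * sqrt v = sqrt (C * d / n * v)"
      unfolding rmse_def by (rule real_sqrt_mult[symmetric])
    also have "C * d / n * v = (12 * \<gamma> * C) * (\<delta>\<^sup>2 * (d / k))" using n0 k by (simp add: v_def field_simps)
    also have "\<dots> \<le> (12 * \<gamma> * C) * (\<delta>\<^sup>2 * 1)" using \<gamma> C kd k by (intro mult_left_mono) auto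
    also have "sqrt \<dots> = \<delta> * sqrt (12 * \<gamma> * C)" using \<delta>0 by (simp add: real_sqrt_mult)
    finally show ?thesis by simp
  qed
  \<comment> \<open>\<open>a - \<beta>\<close> is centred with variance at most \<open>v\<close>, so
    replacing \<open>a\<close> by its mean costs only a correlation with the error of
    \<open>f\<close>. No sensitivity bound is available for so many flips.\<close>
  have ctr: "\<bar>(\<integral>X. ?g X * a X \<partial>P \<theta>) - \<beta> * m j \<theta>\<bar> \<le> \<delta> * sqrt (12 * \<gamma> * C)"
    if [measurable]: "a \<in> borel_measurable D" and a: "\<And>X. 0 \<le> a X" "\<And>X. a X \<le> 1" and \<beta>a: "\<beta> = (\<integral>X. a X \<partial>P \<theta>)"
      and var: "(\<integral>X. (a X - (\<integral>X. a X \<partial>P \<theta>))\<^sup>2 \<partial>P \<theta>) \<le> v" for a \<theta>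
  proof -
    interpret prob_space "P \<theta>" by (rule prob_space_sample)
    have ai: "integrable (P \<theta>) a" using a by (intro integrable_const_bound[of _ 1]) (auto simp: measurable_sample_iff)
    have "0 \<le> \<beta>" "\<beta> \<le> 1" unfolding \<beta>a using a ai by (auto intro!: integral_nonneg_AE integral_le_const)
    hence b: "\<bar>a X - \<beta>\<bar> \<le> 1" for X using a[of X] by auto
    have "integrable (P \<theta>) (\<lambda>X. (a X - \<beta>)\<^sup>2)"
      using b by (intro integrable_const_bound[of _ 1]) (auto simp: measurable_sample_iff abs_square_le_1)
    hence "\<bar>\<integral>X. (?g X - \<theta> j) * (a X - \<beta>) \<partial>P \<theta>\<bar> \<le> rmse * sqrt v"
      using var unfolding \<beta>a[symmetric] by (intro covariance_bound j) auto
    moreover have "(\<integral>X. (?g X - \<theta> j) * (a X - \<beta>) \<partial>P \<theta>) = (\<integral>X. ?g X * a X \<partial>P \<theta>) - \<beta> * m j \<theta>"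
    proof -
      have ga: "integrable (P \<theta>) (\<lambda>X. ?g X * a X)"
        using a by (intro mult_int f_integrable j) (auto simp: abs_le_iff intro: order_trans[of _ 0])
      have "(\<integral>X. (?g X - \<theta> j) * (a X - \<beta>) \<partial>P \<theta>) = (\<integral>X. ?g X * a X - \<beta> * ?g X - \<theta> j * a X + \<theta> j * \<beta> \<partial>P \<theta>)"
        by (intro Bochner_Integration.integral_cong refl) (simp add: algebra_simps)
      also have "\<dots> = (\<integral>X. ?g X * a X \<partial>P \<theta>) - \<beta> * m j \<theta>"
        using ga ai f_integrable[OF j, of \<theta>] prob_space by (simp add: m_def \<beta>a[symmetric])
      finally show ?thesis .
    qed
    ultimately show ?thesis using bv by simp
  qed
  have cp: "(\<integral>X. ?g X * ap X \<partial>P \<nu>) \<le> \<beta> * m j \<nu> + \<delta> * sqrt (12 * \<gamma> * C)"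
    using ctr[of ap \<nu>] a01 fp(3) by (simp add: \<beta>_def v_def abs_le_iff)
  have cm: "(\<integral>X. ?g X * am X \<partial>P \<mu>) \<ge> \<beta> * m j \<mu> - \<delta> * sqrt (12 * \<gamma> * C)"
    using ctr[of am \<mu>] a01 fm(3) by (simp add: \<beta>m v_def abs_le_iff)
  \<comment> \<open>Conditional mean displacement of coordinate \<open>j\<close> given the first
    sample, restricted to at most \<open>k\<close> flips. As an average with weights of total at
    most one it stays below \<open>emp_sens\<close>, and as a finite sum it is measurable.\<close>
  define H where "H X = (\<Sum>T\<in>small. \<bar>f (R T X) j - ?g X\<bar> * wm T X)" for X
  have [measurable]: "H \<in> borel_measurable D" unfolding H_def[abs_def] by measurable
  have H0: "0 \<le> H X" for X unfolding H_def using w01 by (intro sum_nonneg mult_nonneg_nonneg) auto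
  have Hle: "ennreal (H X) \<le> emp_sens d n f \<eta> X" if X: "X \<in> data_space d n" for X
  proof (cases "emp_sens d n f \<eta> X")
    case (real s)
    have one: "\<bar>f (R T X) j - ?g X\<bar> \<le> s" if "T \<in> small" for T
    proof -
      have "finite T" "card T \<le> k" using that by (auto simp: small_def intro: finite_subset)
      hence "ennreal (dist_d d (f X) (f (R T X))) \<le> ennreal s"
        unfolding R_def real(2)[symmetric] by (intro dist_le_emp_sens[OF X]) auto
      hence "dist_d d (f X) (f (R T X)) \<le> s" using real(1) by (simp add: ennreal_le_iff)
      moreover have "(f X j - f (R T X) j)\<^sup>2 \<le> (\<Sum>j<d. (f X j - f (R T X) j)\<^sup>2)"
        using j by (intro member_le_sum) auto
      hence "\<bar>f X j - f (R T X) j\<bar> \<le> dist_d d (f X) (f (R T X))"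
        unfolding dist_d_def by (rule real_le_rsqrt[of "\<bar>_\<bar>", simplified])
      ultimately show ?thesis by (simp add: abs_minus_commute)
    qed
    have "H X \<le> (\<Sum>T\<in>small. s * wm T X)"
      unfolding H_def using one w01 by (intro sum_mono mult_right_mono) auto
    also have "\<dots> \<le> (\<Sum>T\<in>Pow {..<n}. s * wm T X)"
      using w01 real(1) by (intro sum_mono2) (auto simp: small_def)
    also have "\<dots> = s" by (simp add: sum_distrib_left[symmetric] w_sum)
    finally show ?thesis unfolding real(2) by (rule ennreal_leI)
  qed simp
  note Hs = stability_bound[OF \<open>H \<in> borel_measurable D\<close> H0 Hle, of \<mu>]
  have Hint: "(\<integral>X. H X \<partial>P \<mu>) \<le> \<sigma>"
  proof -
    have "\<bar>\<integral>X. H X * 1 \<partial>P \<mu>\<bar> \<le> sqrt (\<integral>X. (H X)\<^sup>2 \<partial>P \<mu>) * sqrt (\<integral>X. 1\<^sup>2 \<partial>P \<mu>)"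
      by (intro Cauchy_Schwarz_integral Hs) (simp_all add: measurable_sample_iff)
    also have "\<dots> \<le> \<sigma>" using Hs(2) \<sigma> Pm.prob_space by (simp add: real_le_lsqrt)
    finally show ?thesis by simp
  qed
  have split: "(\<Sum>T\<in>Pow {..<n}. g T) = (\<Sum>T\<in>small. g T) + (\<Sum>T\<in>large. g T)" for g :: "_ \<Rightarrow> real"
    unfolding un using fin disj by (rule sum.union_disjoint)
  have "m j \<nu> = (\<integral>X. (\<Sum>T\<in>Pow {..<n}. ?g X * wp T X) \<partial>P \<nu>)"
    by (simp add: m_def sum_distrib_left[symmetric] w_sum)
  \<comment> \<open>Only the terms with few flips are transported to \<open>P \<mu>\<close>; the
    others stay under \<open>P \<nu>\<close>, where \<open>ctr\<close> applies.\<close>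
  also have "\<dots> = (\<Sum>T\<in>small. \<integral>X. f (R T X) j * wm T X \<partial>P \<mu>) + (\<integral>X. ?g X * ap X \<partial>P \<nu>)"
    using gwp cov(1)[of ?g] by (simp add: split ap_def sum_distrib_left)
  finally have mp: "m j \<nu> = (\<Sum>T\<in>small. \<integral>X. f (R T X) j * wm T X \<partial>P \<mu>) + (\<integral>X. ?g X * ap X \<partial>P \<nu>)" .
  have "m j \<mu> = (\<integral>X. (\<Sum>T\<in>Pow {..<n}. ?g X * wm T X) \<partial>P \<mu>)"
    by (simp add: m_def sum_distrib_left[symmetric] w_sum)
  also have "\<dots> = (\<Sum>T\<in>small. \<integral>X. ?g X * wm T X \<partial>P \<mu>) + (\<integral>X. ?g X * am X \<partial>P \<mu>)"
    using gwm by (simp add: split am_def sum_distrib_left)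
  finally have mm: "m j \<mu> = (\<Sum>T\<in>small. \<integral>X. ?g X * wm T X \<partial>P \<mu>) + (\<integral>X. ?g X * am X \<partial>P \<mu>)" .
  have "(\<Sum>T\<in>small. \<integral>X. f (R T X) j * wm T X \<partial>P \<mu>) - (\<Sum>T\<in>small. \<integral>X. ?g X * wm T X \<partial>P \<mu>)
      = (\<integral>X. (\<Sum>T\<in>small. (f (R T X) j - ?g X) * wm T X) \<partial>P \<mu>)"
    using gRwm gwm by (simp add: left_diff_distrib sum_subtractf)
  also have "\<dots> \<le> (\<integral>X. H X \<partial>P \<mu>)"
  proof (rule integral_mono)
    show "integrable (P \<mu>) (\<lambda>X. \<Sum>T\<in>small. (f (R T X) j - ?g X) * wm T X)"
      using gRwm gwm by (simp add: left_diff_distrib)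
    show "integrable (P \<mu>) H"
      using Pm.square_integrable_imp_integrable[OF _ Hs(1)] by (simp add: measurable_sample_iff)
    show "(\<Sum>T\<in>small. (f (R T X) j - ?g X) * wm T X) \<le> H X" for X
      unfolding H_def using w01 by (intro sum_mono mult_right_mono) auto
  qed
  also note Hint
  finally have "m j \<nu> - m j \<mu> \<le> \<sigma> + (\<integral>X. ?g X * ap X \<partial>P \<nu>) - (\<integral>X. ?g X * am X \<partial>P \<mu>)"
    using mp mm by linarith
  hence "(1 - \<beta>) * (m j \<nu> - m j \<mu>) \<le> \<sigma> + 2 * \<delta> * sqrt (12 * \<gamma> * C)"
    using cp cm by (simp add: algebra_simps)
  thus ?thesis using that \<beta> unfolding \<nu>_def by blast
qed

text \<open>The grid argument yields a mean and a coordinate whose increment under a shift by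
  \<open>\<delta>\<close> is at least \<open>3 / 4 * \<delta>\<close>;
  \<open>increment_bound\<close> then forces \<open>\<sigma>\<close> to be of order
  \<open>\<delta>\<close>.\<close>

lemma contamination_bound:
  fixes \<gamma> :: real
  assumes kd: "d \<le> k" and \<gamma>: "0 < \<gamma>" "\<gamma> \<le> 1 / 12" "768 * \<gamma> * C \<le> 1"
  shows "\<gamma> / 4 * k / n \<le> \<sigma>"
proof -
  define \<delta> where "\<delta> = \<gamma> * k / n"
  have \<delta>0: "0 < \<delta>" using \<gamma> k n_ge_1 by (simp add: \<delta>_def)
  obtain \<mu> where \<mu>: "3 / 4 * d * \<delta> \<le> (\<Sum>j<d. m j (\<mu>(j := \<mu> j + \<delta>)) - m j \<mu>)"
    using exists_large_divergence[of \<delta> d m rmse, OF \<delta>0 m_close] by blast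
  have "\<exists>j<d. 3 / 4 * \<delta> \<le> m j (\<mu>(j := \<mu> j + \<delta>)) - m j \<mu>"
  proof (rule ccontr)
    assume "\<not> ?thesis"
    hence "(\<Sum>j<d. m j (\<mu>(j := \<mu> j + \<delta>)) - m j \<mu>) < (\<Sum>j<d. 3 / 4 * \<delta>)"
      using d by (intro sum_strict_mono) (auto simp: not_le lessThan_empty_iff)
    thus False using \<mu> by simp
  qed
  then obtain j where j: "j < d" and step: "3 / 4 * \<delta> \<le> m j (\<mu>(j := \<mu> j + \<delta>)) - m j \<mu>" by blast
  obtain \<beta> where \<beta>: "\<beta> \<le> 2 * \<gamma>"
    "(1 - \<beta>) * (m j (\<mu>(j := \<mu> j + \<delta>)) - m j \<mu>) \<le> \<sigma> + 2 * \<delta> * sqrt (12 * \<gamma> * C)"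
    using increment_bound[OF j \<gamma>(1,2) \<delta>_def kd, of \<mu>] by metis
  \<comment> \<open>Since \<open>768 = 12 * 64\<close>, the root is at most 1/8 and the error term
    at most \<open>\<delta> / 4\<close>.\<close>
  have "sqrt (12 * \<gamma> * C) \<le> sqrt ((1 / 8)\<^sup>2)" using \<gamma>(3) by (intro real_sqrt_le_mono) (simp add: power2_eq_square)
  hence "2 * \<delta> * sqrt (12 * \<gamma> * C) \<le> 2 * \<delta> * (1 / 8)" using \<delta>0 by (intro mult_left_mono) auto
  \<comment> \<open>\<open>\<gamma> \<le> 1 / 12\<close> gives
    \<open>1 - \<beta> \<ge> 3 / 4\<close>; of \<open>9 / 16 * \<delta>\<close> more than a quarter
    of \<open>\<delta>\<close> remains after the error term.\<close>
  moreover have "3 / 4 * (3 / 4 * \<delta>) \<le> (1 - \<beta>) * (m j (\<mu>(j := \<mu> j + \<delta>)) - m j \<mu>)"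
    using step \<beta>(1) \<gamma> \<delta>0 by (intro mult_mono) auto
  ultimately have "\<delta> / 4 \<le> \<sigma>" using \<beta>(2) \<delta>0 by linarith
  thus ?thesis by (simp add: \<delta>_def)
qed

end

section \<open>Combining the two regimes\<close>

lemma ennsqrt_le_imp:
  assumes "ennsqrt x \<le> ennreal s" "0 \<le> s"
  shows "x \<le> ennreal (s\<^sup>2)"
proof (cases x)
  case (real r)
  hence "sqrt r \<le> s" using assms by (simp add: ennsqrt_def ennreal_le_iff)
  hence "r \<le> s\<^sup>2" by (simp add: real_sqrt_le_iff' sqrt_le_D)
  thus ?thesis using real by (simp add: ennreal_leI)
next
  case top
  thus ?thesis using assms by (simp add: ennsqrt_def top_unique)
qed

theorem theorem3p1:
  fixes C_MSE :: real
  assumes "C_MSE > 0"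
  shows "\<exists>c::real. \<exists>N0::nat. c > 0 \<and>
    (\<forall>d n f \<eta>. d \<ge> 1 \<longrightarrow> n \<ge> N0 \<longrightarrow> estimator_measurable d n f \<longrightarrow>
       unif_MSE_accurate C_MSE d n f \<longrightarrow> 0 < \<eta> \<longrightarrow> \<eta> < 1 \<longrightarrow> \<lfloor>\<eta> * real n\<rfloor> \<ge> 1 \<longrightarrow>
       (SUP \<mu>. ES2 d n f \<eta> \<mu>) \<ge> ennreal (c * (\<eta> + sqrt (\<eta> * real d / real n))))"
proof -
  \<comment> \<open>The first cap serves the Poisson-type tail bound, the second keeps the
    correlation error in \<open>contamination_bound\<close> small.\<close>
  define \<gamma> where "\<gamma> = min (1 / 12) (1 / (768 * C_MSE))"
  have \<gamma>: "0 < \<gamma>" "\<gamma> \<le> 1 / 12" "768 * \<gamma> * C_MSE \<le> 1"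
  proof -
    show "0 < \<gamma>" "\<gamma> \<le> 1 / 12" using assms by (auto simp: \<gamma>_def)
    have "\<gamma> \<le> 1 / (768 * C_MSE)" by (simp add: \<gamma>_def)
    thus "768 * \<gamma> * C_MSE \<le> 1" using assms by (simp add: field_simps)
  qed
  \<comment> \<open>\<open>4 * c\<close> is the constant \<open>\<gamma> / 4\<close> of
    \<open>contamination_bound\<close>; the factor 4 pays for rounding \<open>\<eta> * n\<close>
    down and for adding two terms.\<close>
  define c where "c = \<gamma> / 16"
  have "ennreal (c * (\<eta> + sqrt (\<eta> * real d / real n))) \<le> (SUP \<mu>. ES2 d n f \<eta> \<mu>)"
    if d: "1 \<le> d" and f: "estimator_measurable d n f" "unif_MSE_accurate C_MSE d n f"
      and \<eta>: "0 < \<eta>" "\<eta> < 1" "1 \<le> \<lfloor>\<eta> * real n\<rfloor>" for d n f \<eta>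
  \<comment> \<open>An infinite supremum is trivial; a finite one serves as
    \<open>\<sigma>\<close>.\<close>
  proof (cases "SUP \<mu>. ES2 d n f \<eta> \<mu>")
    case (real \<sigma>)
    define k where "k = nat \<lfloor>\<eta> * real n\<rfloor>"
    have k1: "1 \<le> k" using \<eta> by (simp add: k_def le_nat_iff)
    have kr: "real k = of_int \<lfloor>\<eta> * real n\<rfloor>" using \<eta> by (simp add: k_def)
    have n0: "0 < n" using \<eta> by (cases n) auto
    have kn: "k \<le> n"
    proof -
      have "real k \<le> \<eta> * n" unfolding kr by (rule of_int_floor_le)
      also have "\<dots> \<le> n" using \<eta> n0 by simp
      finally show ?thesis by simp
    qed
    \<comment> \<open>Since \<open>k \<ge> 1\<close>, rounding down loses at most a factor
      2.\<close>
    have \<eta>k: "\<eta> \<le> 2 * k / n"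
    proof -
      have "\<eta> * n < real k + 1" unfolding kr by (rule real_of_int_floor_add_one_gt)
      hence "\<eta> * n \<le> 2 * k" using k1 by linarith
      thus ?thesis using n0 by (simp add: field_simps)
    qed
    have "ES2 d n f \<eta> \<mu> \<le> ennreal \<sigma>" for \<mu> unfolding real(2)[symmetric] by (rule SUP_upper) simp
    hence stab: "(\<integral>\<^sup>+ X. (emp_sens d n f \<eta> X)\<^sup>2 \<partial>sample d n \<mu>) \<le> ennreal (\<sigma>\<^sup>2)" for \<mu>
      unfolding ES2_def using real(1) by (intro ennsqrt_le_imp)
    interpret stable_estimator d n f C_MSE \<eta> \<sigma> k
      using d k1 kn k_def assms real(1) f stab by unfold_locales auto
    have sq: "sqrt (\<eta> * d / n) \<le> 2 * (sqrt (k * d) / n)"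
    proof -
      have "\<eta> * (d / n) \<le> 2 * k / n * (d / n)"
        by (rule mult_right_mono[OF \<eta>k]) simp
      also have "\<dots> = 2 * (k * d) / n\<^sup>2" by (simp add: power2_eq_square)
      also have "\<dots> \<le> 4 * (k * d) / n\<^sup>2" by (intro divide_right_mono) auto
      finally have "\<eta> * d / n \<le> 4 * (k * d) / n\<^sup>2" by simp
      hence "sqrt (\<eta> * d / n) \<le> sqrt (4 * (k * d) / n\<^sup>2)" by (rule real_sqrt_le_mono)
      also have "\<dots> = 2 * (sqrt (k * d) / n)" by (simp add: real_sqrt_divide real_sqrt_mult)
      finally show ?thesis .
    qed
    have "c * (\<eta> + sqrt (\<eta> * d / n)) \<le> \<sigma>"
    \<comment> \<open>The comparison decides which of \<open>k / n\<close> and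
      \<open>sqrt (k * d) / n\<close> dominates both terms.\<close>
    proof (cases "d \<le> k")
      case True
      hence "sqrt (k * d) \<le> sqrt (real k * k)" by (intro real_sqrt_le_mono) (simp add: mult_left_mono)
      hence "sqrt (k * d) / n \<le> real k / n" by (intro divide_right_mono) auto
      hence "\<eta> + sqrt (\<eta> * d / n) \<le> 4 * (k / n)" using sq \<eta>k by simp
      hence "c * (\<eta> + sqrt (\<eta> * d / n)) \<le> c * (4 * (k / n))" using \<gamma> by (intro mult_left_mono) (auto simp: c_def)
      also have "\<dots> = \<gamma> / 4 * k / n" by (simp add: c_def)
      also have "\<dots> \<le> \<sigma>" by (rule contamination_bound[OF True \<gamma>])
      finally show ?thesis .
    next
      case False
      hence "sqrt (real k * k) \<le> sqrt (k * d)" by (intro real_sqrt_le_mono) (simp add: mult_left_mono)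
      hence "real k / n \<le> sqrt (k * d) / n" by (intro divide_right_mono) auto
      hence "\<eta> + sqrt (\<eta> * d / n) \<le> 4 * (sqrt (k * d) / n)" using sq \<eta>k by simp
      hence "c * (\<eta> + sqrt (\<eta> * d / n)) \<le> (1 / 8) * (4 * (sqrt (k * d) / n))"
        using \<gamma> \<eta> by (intro mult_mono) (auto simp: c_def)
      also have "\<dots> = sqrt (k * d) / (2 * n)" by simp
      also have "\<dots> \<le> \<sigma>" by (rule dimension_bound)
      finally show ?thesis .
    qed
    thus ?thesis unfolding real(2) by (rule ennreal_leI)
  next
    case top
    show ?thesis unfolding top by simp
  qed
  \<comment> \<open>The floor condition forces \<open>n\<close> to be positive, so \<open>0\<close>
    serves as \<open>N0\<close>.\<close>
  thus ?thesis using \<gamma>(1) by (intro exI[of _ c] exI[of _ 0]) (auto simp: c_def)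
qed

end
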